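(* Let an initial point $x_0\in\mathrm{dom}\,h$, a tolerance $\bar\varepsilon>0$ and a prox stepsize $\lambda>0$ be given, and consider an instance $(f,f';h)$ of $\min\{\phi(x)=f(x)+h(x):x\in\mathbb{R}^n\}$ satisfying (A1)-(A3). Then the number of iterations performed by 1C-APB until it obtains a $\bar\varepsilon$-solution is bounded by $$\left[2\left(1+\frac{8\lambda_\mu T_{\bar\varepsilon}^2}{\bar\varepsilon}\right)\log_+\left(\frac{4\bar t}{\bar\varepsilon}\right)+1\right]\left[\min\left\{\frac{d_0^2}{\lambda\bar\varepsilon},\frac1{\mu\lambda_\mu}\log\left(\frac{\mu d_0^2}{\bar\varepsilon}+1\right)\right\}+1\right],$$ where $\lambda_\mu=\lambda/(1+\lambda\mu)$. As a consequence, if in addition, for a universal constant $C>0$, $$\frac{\bar\varepsilon}{CT_{\bar\varepsilon}^2}\le\lambda\le\frac{Cd_0^2}{\bar\varepsilon},$$ then the $\bar\varepsilon$-iteration complexity of 1C-APB is, up to a logarithmic term, $$\mathcal{O}\left(\min\left\{\frac{T_{\bar\varepsilon}^2d_0^2}{\bar\varepsilon^2},\left(\frac{T_{\bar\varepsilon}^2}{\mu\bar\varepsilon}+1\right)\log\left(\frac{\mu d_0^2}{\bar\varepsilon}+1\right)\right\}+1\right),$$ that is, the number of iterations is at most $C'(1+\log_+(4\bar t/\bar\varepsilon))$ times the expression inside $\mathcal{O}(\cdot)$, for a constant $C'>0$ depending only on $C$.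
   Context: Notation. $\|\cdot\|$ and $\langle\cdot,\cdot\rangle$ are the Euclidean norm and inner product on $\mathbb{R}^n$; $\log$ is the natural logarithm; $\log_+(s)=\max\{0,\log s\}$ for $s>0$ and $\log_+(0)=0$. For $\mu\ge0$, $\overline{\mathrm{Conv}}_\mu(\mathbb{R}^n)$ is the set of proper lower semicontinuous functions $\Psi:\mathbb{R}^n\to(-\infty,+\infty]$ such that $\Psi-\mu\|\cdot\|^2/2$ is convex; $\overline{\mathrm{Conv}}(\mathbb{R}^n)$ is the case $\mu=0$. Problem. $\phi_*=\min\{\phi(x):=f(x)+h(x):x\in\mathbb{R}^n\}$. A $\bar\varepsilon$-solution is a point $\bar x\in\mathrm{dom}\,h$ with $\phi(\bar x)-\phi_*\le\bar\varepsilon$. The assumptions for a triple $(L_f,M_f,\mu)\in\mathbb{R}_+^3$ are: (A1) $f\in\overline{\mathrm{Conv}}(\mathbb{R}^n)$, $h\in\overline{\mathrm{Conv}}_\mu(\mathbb{R}^n)$, $\mathrm{dom}\,h\subset\mathrm{dom}\,f$, and $f':\mathrm{dom}\,h\to\mathbb{R}^n$ is a given function with $f'(x)\in\partial f(x)$ for all $x\in\mathrm{dom}\,h$; (A2) the set $X^*$ of optimal solutions is nonempty; (A3) $\|f'(x)-f'(y)\|\le2M_f+L_f\|x-y\|$ for all $x,y\in\mathrm{dom}\,h$. Let $\ell_f(u;x)=f(x)+\langle f'(x),u-x\rangle$, $x_0^*=\mathrm{argmin}\{\|x_0-x^*\|:x^*\in X^*\}$ and $d_0=\|x_0-x_0^*\|$.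 Let $\Omega\subset\mathbb{R}_+^2$ be the set of all pairs $(M,L)$ for which (A3) holds with $(M_f,L_f)=(M,L)$; $(\bar M_f,\bar L_f)$ is the unique minimizer of $M^2+\bar\varepsilon L$ over $\Omega$, and $T_{\bar\varepsilon}=(\bar M_f^2+\bar\varepsilon\bar L_f)^{1/2}$. Also $$\bar t:=\bar M_f^2+4(\bar L_f+2)\bigl(\max\{1,2\lambda\bar L_f\}d_0+\lambda\bar M_f\bigr)^2.$$ When $\mu=0$, the second term of each minimum is by convention equal to the first. 1C-APB (one-cut adaptive proximal bundle method). Step 0. Given $x_0\in\mathrm{dom}\,h$, $\lambda>0$, $\beta\ge1$, $\bar\varepsilon>0$, set $y_0=x_0$, $t_0=0$, $\tau_0=0$, $j=1$. Step 1. Set $\tau=\tau_{j-1}/\beta$. Step 2. If $t_{j-1}\le\bar\varepsilon/2$ (serious update), set $x_j^c=x_{j-1}$ and $\Gamma_j=\ell_f(\cdot;x_{j-1})+h$; else (null update), set $x_j^c=x_{j-1}^c$ and $\Gamma_j=\tau\Gamma_{j-1}+(1-\tau)[\ell_f(\cdot;x_{j-1})+h]$. Step 3. Compute $x_j=\mathrm{argmin}_u\{\Gamma_j(u)+\frac1{2\lambda}\|u-x_j^c\|^2\}$, choose $y_j\in\mathrm{Argmin}\{\phi(x):x\in\{x_0,\dots,x_j\}\}$, and set $m_j=\Gamma_j(x_j)+\frac1{2\lambda}\|x_j-x_j^c\|^2$, $t_j=\phi(y_j)-m_j$. Step 4. If $t_{j-1}>\bar\varepsilon/2$ and $t_j>\tau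 t_{j-1}+(1-\tau)\bar\varepsilon/4$, set $\tau=(1+\tau)/2$ and go to Step 2 (recomputing the quantities indexed by $j$); else set $\tau_j=\tau$, $j\leftarrow j+1$, and go to Step 1. Iterations are counted by the index $j$ (returns from Step 4 to Step 2 are not counted as iterations); the number of iterations to obtain a $\bar\varepsilon$-solution is the first $j$ for which the final $y_j$ is a $\bar\varepsilon$-solution. *)

theory Defs
  imports "HOL-Analysis.Analysis"
begin

section \<open>Euclidean spaces of varying dimension\<close>

text \<open>
  The constant hidden in the complexity bound must not depend on the dimension \<open>n\<close>, so \<open>n\<close> has to
  be quantified inside the theorem, behind that constant. Hence \<open>\<real>\<^sup>n\<close> is rendered as the subspace
  \<open>Rn n\<close> of one fixed inner product space: the finitely supported real sequences with the inner
  product \<open>\<Sum>i. x i * y i\<close>.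
\<close>

typedef rvec = "{x :: nat \<Rightarrow> real. finite {i. x i \<noteq> 0}}"
  morphisms coord Abs_rvec
  by (rule exI[of _ "\<lambda>_. 0"]) simp

setup_lifting type_definition_rvec

lemma finite_coord: "finite {i. coord x i \<noteq> 0}"
  using coord[of x] by simp

lemma rvec_eq_iff: "x = y \<longleftrightarrow> (\<forall>i. coord x i = coord y i)"
  by (simp add: coord_inject[symmetric] fun_eq_iff)

instantiation rvec :: real_vector
begin

lift_definition zero_rvec :: rvec is "\<lambda>_. 0" by simp

lift_definition plus_rvec :: "rvec \<Rightarrow> rvec \<Rightarrow> rvec" is "\<lambda>x y i. x i + y i"
  subgoal for x y
    by (rule finite_subset[of _ "{i. x i \<noteq> 0} \<union> {i. y i \<noteq> 0}"]) auto
  done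

lift_definition uminus_rvec :: "rvec \<Rightarrow> rvec" is "\<lambda>x i. - x i" by simp

lift_definition minus_rvec :: "rvec \<Rightarrow> rvec \<Rightarrow> rvec" is "\<lambda>x y i. x i - y i"
  subgoal for x y
    by (rule finite_subset[of _ "{i. x i \<noteq> 0} \<union> {i. y i \<noteq> 0}"]) auto
  done

lift_definition scaleR_rvec :: "real \<Rightarrow> rvec \<Rightarrow> rvec" is "\<lambda>r x i. r * x i"
  by (rule finite_subset) auto

instance
  by standard (transfer; simp add: fun_eq_iff algebra_simps)+

end

lemma coord_simps [simp]:
  "coord 0 i = 0" "coord (x + y) i = coord x i + coord y i" "coord (- x) i = - coord x i"
  "coord (x - y) i = coord x i - coord y i" "coord (r *\<^sub>R x) i = r * coord x i"
  by (simp_all add: zero_rvec.rep_eq plus_rvec.rep_eq uminus_rvec.rep_eq minus_rvec.rep_eq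
      scaleR_rvec.rep_eq)

definition dot_rvec :: "rvec \<Rightarrow> rvec \<Rightarrow> real" where
  "dot_rvec x y = (\<Sum>i | coord x i \<noteq> 0. coord x i * coord y i)"

lemma dot_rvec_superset:
  assumes "finite A" "{i. coord x i \<noteq> 0} \<subseteq> A"
  shows "dot_rvec x y = (\<Sum>i\<in>A. coord x i * coord y i)"
  unfolding dot_rvec_def using assms by (intro sum.mono_neutral_left) auto

instantiation rvec :: real_inner
begin

definition inner_rvec :: "rvec \<Rightarrow> rvec \<Rightarrow> real" where "inner_rvec = dot_rvec"
definition norm_rvec :: "rvec \<Rightarrow> real" where "norm_rvec x = sqrt (dot_rvec x x)"
definition dist_rvec :: "rvec \<Rightarrow> rvec \<Rightarrow> real" where "dist_rvec x y = norm (x - y)"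
definition sgn_rvec :: "rvec \<Rightarrow> rvec" where "sgn_rvec x = x /\<^sub>R norm x"
definition uniformity_rvec :: "(rvec \<times> rvec) filter" where
  "uniformity_rvec = (INF e\<in>{0<..}. principal {(x, y). dist x y < e})"
definition open_rvec :: "rvec set \<Rightarrow> bool" where
  "open_rvec U \<longleftrightarrow> (\<forall>x\<in>U. \<forall>\<^sub>F (x', y) in uniformity. x' = x \<longrightarrow> y \<in> U)"

instance
proof
  fix x y z :: rvec and r :: real and U :: "rvec set"
  show "dist x y = norm (x - y)" by (rule dist_rvec_def)
  show "sgn x = x /\<^sub>R norm x" by (rule sgn_rvec_def)
  show "(uniformity :: (rvec \<times> rvec) filter) = (INF e\<in>{0<..}. principal {(x, y). dist x y < e})"
    by (rule uniformity_rvec_def)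
  show "open U \<longleftrightarrow> (\<forall>x\<in>U. \<forall>\<^sub>F (x', y) in uniformity. x' = x \<longrightarrow> y \<in> U)"
    by (rule open_rvec_def)
  let ?S = "\<lambda>x. {i. coord x i \<noteq> 0}"
  let ?A = "?S x \<union> ?S y \<union> ?S z"
  have fin: "finite ?A" by (simp add: finite_coord)
  have e: "inner u v = (\<Sum>i\<in>?A. coord u i * coord v i)" if "?S u \<subseteq> ?A" for u v :: rvec
    unfolding inner_rvec_def by (rule dot_rvec_superset[OF fin that])
  have s: "?S x \<subseteq> ?A" "?S y \<subseteq> ?A" "?S (x + y) \<subseteq> ?A" "?S (r *\<^sub>R x) \<subseteq> ?A" by auto
  show "inner x y = inner y x" by (simp only: e[OF s(1)] e[OF s(2)] mult.commute)
  show "inner (x + y) z = inner x z + inner y z"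
    by (simp only: e[OF s(1)] e[OF s(2)] e[OF s(3)] coord_simps distrib_right sum.distrib)
  show "inner (r *\<^sub>R x) y = r * inner x y"
    by (simp only: e[OF s(1)] e[OF s(4)] coord_simps mult.assoc sum_distrib_left)
  show "0 \<le> inner x x" unfolding e[OF s(1)] by (intro sum_nonneg) simp
  show "inner x x = 0 \<longleftrightarrow> x = 0"
    unfolding inner_rvec_def dot_rvec_def
    by (subst sum_nonneg_eq_0_iff) (auto simp: finite_coord rvec_eq_iff)
  show "norm x = sqrt (inner x x)" by (simp add: norm_rvec_def inner_rvec_def)
qed

end

definition Rn :: "nat \<Rightarrow> rvec set" where
  "Rn n = {x. \<forall>i\<ge>n. coord x i = 0}"

lemma inner_Rn:
  assumes "x \<in> Rn n"
  shows "inner x y = (\<Sum>i<n. coord x i * coord y i)"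
  unfolding inner_rvec_def
  by (rule dot_rvec_superset) (use assms in \<open>auto simp: Rn_def not_le[symmetric]\<close>)

lemma Rn_onto: "\<exists>x\<in>Rn n. \<forall>i<n. coord x i = v i"
proof -
  let ?g = "\<lambda>i. if i < n then v i else 0"
  have "finite {i. ?g i \<noteq> 0}" by (rule finite_subset[of _ "{..<n}"]) auto
  then have "coord (Abs_rvec ?g) = ?g" by (intro Abs_rvec_inverse) simp
  then show ?thesis by (intro bexI[of _ "Abs_rvec ?g"]) (auto simp: Rn_def)
qed

section \<open>Convex functions\<close>

text \<open>
  Below, \<open>V\<close> is the space on which the problem is posed. Extended-valued functions are total on the
  ambient type; only their values on \<open>V\<close> matter.
\<close>

definition edom :: "'a set \<Rightarrow> ('a \<Rightarrow> ereal) \<Rightarrow> 'a set" where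
  "edom V \<Psi> = {x\<in>V. \<Psi> x < \<infinity>}"

definition proper_on :: "'a set \<Rightarrow> ('a \<Rightarrow> ereal) \<Rightarrow> bool" where
  "proper_on V \<Psi> \<longleftrightarrow> (\<forall>x\<in>V. \<Psi> x \<noteq> -\<infinity>) \<and> edom V \<Psi> \<noteq> {}"

definition lsc_on :: "'a::topological_space set \<Rightarrow> ('a \<Rightarrow> ereal) \<Rightarrow> bool" where
  "lsc_on V \<Psi> \<longleftrightarrow> (\<forall>x\<in>V. \<Psi> x \<le> Liminf (at x within V) \<Psi>)"

definition econvex_on :: "'a::real_vector set \<Rightarrow> ('a \<Rightarrow> ereal) \<Rightarrow> bool" where
  "econvex_on V \<Psi> \<longleftrightarrow> (\<forall>x\<in>V. \<forall>y\<in>V. \<forall>t. 0 < t \<and> t < 1 \<longrightarrow>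
     \<Psi> ((1 - t) *\<^sub>R x + t *\<^sub>R y) \<le> ereal (1 - t) * \<Psi> x + ereal t * \<Psi> y)"

definition Conv :: "'a::real_inner set \<Rightarrow> real \<Rightarrow> ('a \<Rightarrow> ereal) set" where
  "Conv V \<mu> = {\<Psi>. proper_on V \<Psi> \<and> lsc_on V \<Psi> \<and>
     econvex_on V (\<lambda>x. \<Psi> x - ereal (\<mu> * (norm x)\<^sup>2 / 2))}"

definition subdifferential :: "'a::real_inner set \<Rightarrow> ('a \<Rightarrow> ereal) \<Rightarrow> 'a \<Rightarrow> 'a set" where
  "subdifferential V f x = {v\<in>V. \<forall>u\<in>V. f u \<ge> f x + ereal (inner v (u - x))}"

section \<open>The composite problem\<close>

definition objective :: "('a \<Rightarrow> ereal) \<Rightarrow> ('a \<Rightarrow> ereal) \<Rightarrow> 'a \<Rightarrow> ereal" where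
  "objective f h x = f x + h x"

definition opt_set :: "'a set \<Rightarrow> ('a \<Rightarrow> ereal) \<Rightarrow> ('a \<Rightarrow> ereal) \<Rightarrow> 'a set" where
  "opt_set V f h = {x\<in>V. \<forall>u\<in>V. objective f h x \<le> objective f h u}"

definition opt_val :: "'a set \<Rightarrow> ('a \<Rightarrow> ereal) \<Rightarrow> ('a \<Rightarrow> ereal) \<Rightarrow> ereal" where
  "opt_val V f h = (INF x\<in>V. objective f h x)"

definition eps_solution ::
    "'a set \<Rightarrow> ('a \<Rightarrow> ereal) \<Rightarrow> ('a \<Rightarrow> ereal) \<Rightarrow> real \<Rightarrow> 'a \<Rightarrow> bool" where
  "eps_solution V f h \<epsilon> x \<longleftrightarrow> x \<in> edom V h \<and> objective f h x - opt_val V f h \<le> ereal \<epsilon>"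

definition hybrid_bound ::
    "'a::real_inner set \<Rightarrow> ('a \<Rightarrow> 'a) \<Rightarrow> ('a \<Rightarrow> ereal) \<Rightarrow> real \<Rightarrow> real \<Rightarrow> bool" where
  "hybrid_bound V f' h M L \<longleftrightarrow>
     (\<forall>x\<in>edom V h. \<forall>y\<in>edom V h. norm (f' x - f' y) \<le> 2 * M + L * norm (x - y))"

definition problem_assms ::
    "'a::real_inner set \<Rightarrow> ('a \<Rightarrow> ereal) \<Rightarrow> ('a \<Rightarrow> 'a) \<Rightarrow> ('a \<Rightarrow> ereal) \<Rightarrow> real \<Rightarrow> real \<Rightarrow> real \<Rightarrow> bool"
  where
  "problem_assms V f f' h M L \<mu> \<longleftrightarrow> M \<ge> 0 \<and> L \<ge> 0 \<and> \<mu> \<ge> 0 \<and>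
     f \<in> Conv V 0 \<and> h \<in> Conv V \<mu> \<and> edom V h \<subseteq> edom V f \<and>
     (\<forall>x\<in>edom V h. f' x \<in> subdifferential V f x) \<and>
     opt_set V f h \<noteq> {} \<and>
     hybrid_bound V f' h M L"

text \<open>The distance \<open>d\<^sub>0\<close> from \<open>x\<^sub>0\<close> to its projection onto the set of optimal solutions.\<close>

definition opt_dist ::
    "'a::real_inner set \<Rightarrow> ('a \<Rightarrow> ereal) \<Rightarrow> ('a \<Rightarrow> ereal) \<Rightarrow> 'a \<Rightarrow> real" where
  "opt_dist V f h x0 = norm (x0 - arg_min (\<lambda>x. norm (x0 - x)) (\<lambda>x. x \<in> opt_set V f h))"

definition Omega ::
    "'a::real_inner set \<Rightarrow> ('a \<Rightarrow> 'a) \<Rightarrow> ('a \<Rightarrow> ereal) \<Rightarrow> (real \<times> real) set" where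
  "Omega V f' h = {(M, L). M \<ge> 0 \<and> L \<ge> 0 \<and> hybrid_bound V f' h M L}"

definition best_pair ::
    "'a::real_inner set \<Rightarrow> ('a \<Rightarrow> 'a) \<Rightarrow> ('a \<Rightarrow> ereal) \<Rightarrow> real \<Rightarrow> real \<times> real" where
  "best_pair V f' h \<epsilon> = arg_min (\<lambda>(M, L). M\<^sup>2 + \<epsilon> * L) (\<lambda>p. p \<in> Omega V f' h)"

definition T_eps ::
    "'a::real_inner set \<Rightarrow> ('a \<Rightarrow> 'a) \<Rightarrow> ('a \<Rightarrow> ereal) \<Rightarrow> real \<Rightarrow> real" where
  "T_eps V f' h \<epsilon> = (let (M, L) = best_pair V f' h \<epsilon> in sqrt (M\<^sup>2 + \<epsilon> * L))"

definition t_bar ::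
    "'a::real_inner set \<Rightarrow> ('a \<Rightarrow> ereal) \<Rightarrow> ('a \<Rightarrow> 'a) \<Rightarrow> ('a \<Rightarrow> ereal) \<Rightarrow> 'a \<Rightarrow> real \<Rightarrow> real \<Rightarrow> real"
  where
  "t_bar V f f' h x0 lam \<epsilon> = (let (M, L) = best_pair V f' h \<epsilon> in
     M\<^sup>2 + 4 * (L + 2) * (max 1 (2 * lam * L) * opt_dist V f h x0 + lam * M)\<^sup>2)"

section \<open>The one-cut adaptive proximal bundle method\<close>

definition linearization ::
    "('a::real_inner \<Rightarrow> ereal) \<Rightarrow> ('a \<Rightarrow> 'a) \<Rightarrow> 'a \<Rightarrow> 'a \<Rightarrow> ereal" where
  "linearization f f' x u = f x + ereal (inner (f' x) (u - x))"

text \<open>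
  Iteration \<open>j\<close> consists of one or more trials, each with its own \<open>\<tau>\<close>. A state is the start of a
  trial: it holds the accepted data of iteration \<open>j - 1\<close> and the \<open>\<tau>\<close> about to be tried. A step of
  the transition relation below is one trial. If it is rejected, only \<open>\<tau>\<close> changes, to
  \<open>(1 + \<tau>) / 2\<close>; if it is accepted, then \<open>\<tau>\<^sub>j = \<tau>\<close> and iteration \<open>j + 1\<close> starts with \<open>\<tau>\<^sub>j / \<beta>\<close>.
\<close>

record 'a apb_state =
  completed :: nat                   \<comment> \<open>\<open>j - 1\<close>\<close>
  visited :: "'a set"                \<comment> \<open>\<open>{x\<^sub>0, \<dots>, x\<^bsub>j-1\<^esub>}\<close>\<close>
  current :: 'a                      \<comment> \<open>\<open>x\<^bsub>j-1\<^esub>\<close>\<close>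
  best :: 'a                         \<comment> \<open>\<open>y\<^bsub>j-1\<^esub>\<close>\<close>
  center :: 'a                       \<comment> \<open>prox center of iteration \<open>j - 1\<close>; irrelevant for \<open>j = 1\<close>\<close>
  model :: "'a \<Rightarrow> ereal"             \<comment> \<open>\<open>\<Gamma>\<^bsub>j-1\<^esub>\<close>; irrelevant for \<open>j = 1\<close>\<close>
  gap :: ereal                       \<comment> \<open>\<open>t\<^bsub>j-1\<^esub>\<close>\<close>
  trial :: real                      \<comment> \<open>the current \<open>\<tau>\<close>\<close>

text \<open>Iteration \<open>1\<close> starts with \<open>\<tau> = \<tau>\<^sub>0 / \<beta> = 0\<close>, since \<open>\<tau>\<^sub>0 = 0\<close>.\<close>

definition apb_init :: "'a \<Rightarrow> 'a apb_state \<Rightarrow> bool" where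
  "apb_init x0 s \<longleftrightarrow> completed s = 0 \<and> visited s = {x0} \<and> current s = x0 \<and> best s = x0 \<and>
     gap s = 0 \<and> trial s = 0"

definition serious :: "real \<Rightarrow> 'a apb_state \<Rightarrow> bool" where
  "serious \<epsilon> s \<longleftrightarrow> gap s \<le> ereal (\<epsilon> / 2)"

definition new_center :: "real \<Rightarrow> 'a apb_state \<Rightarrow> 'a" where
  "new_center \<epsilon> s = (if serious \<epsilon> s then current s else center s)"

definition new_model ::
    "('a::real_inner \<Rightarrow> ereal) \<Rightarrow> ('a \<Rightarrow> 'a) \<Rightarrow> ('a \<Rightarrow> ereal) \<Rightarrow> real \<Rightarrow> 'a apb_state \<Rightarrow> 'a \<Rightarrow> ereal"
  where
  "new_model f f' h \<epsilon> s u =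
     (let cut = linearization f f' (current s) u + h u in
      if serious \<epsilon> s then cut
      else ereal (trial s) * model s u + ereal (1 - trial s) * cut)"

definition prox_objective ::
    "('a::real_inner \<Rightarrow> ereal) \<Rightarrow> ('a \<Rightarrow> 'a) \<Rightarrow> ('a \<Rightarrow> ereal) \<Rightarrow> real \<Rightarrow> real \<Rightarrow> 'a apb_state
      \<Rightarrow> 'a \<Rightarrow> ereal" where
  "prox_objective f f' h lam \<epsilon> s u =
     new_model f f' h \<epsilon> s u + ereal ((norm (u - new_center \<epsilon> s))\<^sup>2 / (2 * lam))"

definition apb_step ::
    "'a::real_inner set \<Rightarrow> ('a \<Rightarrow> ereal) \<Rightarrow> ('a \<Rightarrow> 'a) \<Rightarrow> ('a \<Rightarrow> ereal) \<Rightarrow> real \<Rightarrow> real \<Rightarrow> real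
      \<Rightarrow> 'a apb_state \<Rightarrow> 'a apb_state \<Rightarrow> bool" where
  "apb_step V f f' h lam \<beta> \<epsilon> s s' \<longleftrightarrow> (\<exists>x y.
     is_arg_min (prox_objective f f' h lam \<epsilon> s) (\<lambda>u. u \<in> V) x \<and>
     is_arg_min (objective f h) (\<lambda>z. z \<in> insert x (visited s)) y \<and>
     (let t = objective f h y - prox_objective f f' h lam \<epsilon> s x; \<tau> = trial s in
      s' = (if gap s > ereal (\<epsilon> / 2) \<and> t > ereal \<tau> * gap s + ereal ((1 - \<tau>) * \<epsilon> / 4)
            then s\<lparr>trial := (1 + \<tau>) / 2\<rparr>
            else \<lparr>completed = completed s + 1, visited = insert x (visited s), current = x,
                  best = y, center = new_center \<epsilon> s, model = new_model f f' h \<epsilon> s,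
                  gap = t, trial = \<tau> / \<beta>\<rparr>)))"

definition apb_run ::
    "'a::real_inner set \<Rightarrow> ('a \<Rightarrow> ereal) \<Rightarrow> ('a \<Rightarrow> 'a) \<Rightarrow> ('a \<Rightarrow> ereal) \<Rightarrow> 'a \<Rightarrow> real \<Rightarrow> real \<Rightarrow> real
      \<Rightarrow> (nat \<Rightarrow> 'a apb_state) \<Rightarrow> bool" where
  "apb_run V f f' h x0 lam \<beta> \<epsilon> \<sigma> \<longleftrightarrow>
     apb_init x0 (\<sigma> 0) \<and> (\<forall>k. apb_step V f f' h lam \<beta> \<epsilon> (\<sigma> k) (\<sigma> (Suc k)))"

text \<open>
  The first \<open>j\<close> whose final \<open>y\<^sub>j\<close> is an \<open>\<epsilon>\<close>-solution. It is \<open>\<infinity>\<close> if there is none, in particular if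
  some iteration rejects its trials forever before an \<open>\<epsilon>\<close>-solution has been accepted.
\<close>

definition num_iterations ::
    "'a set \<Rightarrow> ('a \<Rightarrow> ereal) \<Rightarrow> ('a \<Rightarrow> ereal) \<Rightarrow> real \<Rightarrow> (nat \<Rightarrow> 'a apb_state) \<Rightarrow> enat" where
  "num_iterations V f h \<epsilon> \<sigma> =
     (INF k\<in>{k. eps_solution V f h \<epsilon> (best (\<sigma> k))}. enat (completed (\<sigma> k)))"

section \<open>The complexity bounds\<close>

text \<open>
  In the two bounds below, \<open>T\<close>, \<open>d\<close>, \<open>t\<close> stand for \<open>T_eps\<close>, \<open>opt_dist\<close>, \<open>t_bar\<close>. For \<open>\<mu> = 0\<close> the second
  term of each minimum is by convention the first one; division by \<open>0\<close> would instead make it \<open>0\<close>.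
  For the same reason the hypothesis \<open>\<epsilon> / (C * T\<^sup>2) \<le> lam\<close> of the theorem comes with \<open>T > 0\<close>: on paper
  it fails for \<open>T = 0\<close>.
\<close>

definition log_plus :: "real \<Rightarrow> real" where
  "log_plus s = (if s > 0 then max 0 (ln s) else 0)"

definition lambda_mu :: "real \<Rightarrow> real \<Rightarrow> real" where
  "lambda_mu lam \<mu> = lam / (1 + lam * \<mu>)"

definition iteration_bound :: "real \<Rightarrow> real \<Rightarrow> real \<Rightarrow> real \<Rightarrow> real \<Rightarrow> real \<Rightarrow> real" where
  "iteration_bound lam \<mu> \<epsilon> T d t =
     (2 * (1 + 8 * lambda_mu lam \<mu> * T\<^sup>2 / \<epsilon>) * log_plus (4 * t / \<epsilon>) + 1) *
     ((if \<mu> = 0 then d\<^sup>2 / (lam * \<epsilon>)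
       else min (d\<^sup>2 / (lam * \<epsilon>)) (1 / (\<mu> * lambda_mu lam \<mu>) * ln (\<mu> * d\<^sup>2 / \<epsilon> + 1))) + 1)"

definition complexity_order :: "real \<Rightarrow> real \<Rightarrow> real \<Rightarrow> real \<Rightarrow> real" where
  "complexity_order \<mu> \<epsilon> T d =
     (if \<mu> = 0 then T\<^sup>2 * d\<^sup>2 / \<epsilon>\<^sup>2
      else min (T\<^sup>2 * d\<^sup>2 / \<epsilon>\<^sup>2) ((T\<^sup>2 / (\<mu> * \<epsilon>) + 1) * ln (\<mu> * d\<^sup>2 / \<epsilon> + 1))) + 1"

end

theory Submission
  imports Defs
begin

text \<open>
  Write \<open>\<phi> = f + h\<close> and let \<open>x\<^sup>*\<close> be the optimal point nearest to \<open>x\<^sub>0\<close>. The iterations split into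
  cycles: a cycle starts with a serious update, keeps its prox center during null updates, and
  closes at the first gap \<open>t \<le> \<epsilon> / 2\<close>. The two factors of the bound count the two levels.

  \<^emph>\<open>Few cycles.\<close> Every model is a minorant of \<open>\<phi>\<close> that is strongly convex with modulus \<open>\<mu>\<close>, so its
  proximal problem grows with modulus \<open>\<mu> + 1 / lam\<close> around its minimizer
  (\<open>prox_quadratic_growth\<close>). Comparing the minimizer with \<open>x\<^sup>*\<close> at the end of a cycle gives, as long as
  no \<open>\<epsilon>\<close>-solution has been found, \<open>(1 + lam * \<mu>) r'\<^sup>2 + lam * \<epsilon> \<le> r\<^sup>2\<close> for the distances \<open>r\<close>, \<open>r'\<close> of
  successive centers to \<open>x\<^sup>*\<close> (\<open>serious_step_decrease\<close>). Unrolling this recursion, once additively and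
  once multiplicatively, bounds the number of closed cycles by each term of the minimum
  (\<open>serious_progress_count\<close>).

  \<^emph>\<open>Short cycles.\<close> Once \<open>\<tau>\<close> is so close to \<open>1\<close> that the quadratic growth gained from the old model
  outweighs the linearization error of the new cut, the acceptance test cannot fail
  (\<open>null_step_gap\<close>). A trial value is raised, by halving its distance to \<open>1\<close>, only when it lies below
  that threshold, and the division by \<open>\<beta>\<close> lowers it, so \<open>1 - \<tau>\<close> is always at least half of the distance
  of the threshold to \<open>1\<close>. Hence every accepted null update contracts \<open>t - \<epsilon> / 4\<close> by a fixed factor;
  started from a first gap of at most \<open>t_bar\<close> (\<open>serious_step_gap\<close>), it falls to \<open>\<epsilon> / 4\<close> after
  logarithmically many updates (\<open>geometric_decay_length\<close>). The same threshold shows that no iteration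
  rejects its trials forever.

  These facts are collected in an invariant of the transition system (\<open>apb_step_invariant\<close>), valid
  for any optimal point and any pair \<open>(M, L)\<close> admissible in the hybrid condition; the nearest
  optimal point and the best pair, which exist by compactness, are inserted only at the end.
\<close>

section \<open>Logarithmic length of a geometric decay\<close>

lemma ln_ge_two_mul_diff_div_sum:
  fixes y :: real
  assumes "y \<ge> 1"
  shows "2 * (y - 1) / (y + 1) \<le> ln y"
proof -
  let ?g = "\<lambda>y::real. ln y - 2 * (y - 1) / (y + 1)"
  have "?g 1 \<le> ?g y"
  proof (rule DERIV_nonneg_imp_nondecreasing[OF assms])
    fix z :: real assume z: "1 \<le> z" "z \<le> y"
    have "(?g has_real_derivative (1 / z - 4 / (z + 1)\<^sup>2)) (at z)"
      using z by (auto intro!: derivative_eq_intros simp: field_simps power2_eq_square)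
    moreover have "4 / (z + 1)\<^sup>2 \<le> 1 / z"
    proof -
      have "4 * z \<le> (z + 1)\<^sup>2"
        using zero_le_power2[of "z - 1"] by (simp add: power2_eq_square algebra_simps)
      then show ?thesis using z by (simp add: divide_simps mult.commute)
    qed
    ultimately show "\<exists>D. (?g has_real_derivative D) (at z) \<and> 0 \<le> D"
      by (metis diff_ge_0_iff_ge)
  qed
  then show ?thesis by simp
qed

text \<open>
  How many contractions by \<open>1 - 1 / A\<close> keep \<open>s - 1\<close> above \<open>1\<close>. The estimate \<open>- ln (1 - 1 / A) \<ge> 1 / A\<close>
  would bound \<open>n\<close>, but the claim is about \<open>n + 1\<close>. The missing unit is paid for by the sharper
  \<open>- ln (1 - 1 / A) \<ge> 1 / (A - 1 / 2)\<close>, which saves \<open>ln (s - 1) / 2\<close>, together with the difference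
  \<open>A * ln s - A * ln (s - 1) \<ge> 2 / s\<close>; these two savings add up to at least \<open>1\<close>.
\<close>

lemma geometric_decay_length:
  fixes A s :: real
  assumes A: "A \<ge> 2" and n: "(1 - 1 / A) ^ n * (s - 1) > 1"
  shows "real n + 1 \<le> A * ln s"
proof -
  define r where "r = 1 - 1 / A"
  have r: "0 < r" "r < 1" using A by (auto simp: r_def field_simps)
  have n': "r ^ n * (s - 1) > 1" using n by (simp add: r_def)
  have s: "s > 2"
  proof (rule ccontr)
    assume "\<not> s > 2"
    then have "r ^ n * (s - 1) \<le> r ^ n * 1" using r by (intro mult_left_mono) auto
    also have "\<dots> \<le> 1" using r by (simp add: power_le_one)
    finally show False using n' by simp
  qed
  have "0 < ln (r ^ n * (s - 1))" using n' by simp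
  also have "\<dots> = ln (s - 1) - real n * ln (1 / r)"
    using r s by (simp add: ln_mult ln_realpow ln_div)
  finally have 1: "real n * ln (1 / r) < ln (s - 1)" by simp
  have "2 * (1 / r - 1) / (1 / r + 1) = 2 / (2 * A - 1)"
  proof -
    have "1 / r = A / (A - 1)" using A by (simp add: r_def field_simps)
    then have "1 / r - 1 = 1 / (A - 1)" "1 / r + 1 = (2 * A - 1) / (A - 1)"
      using A by (simp_all add: field_simps)
    then have "2 * (1 / r - 1) / (1 / r + 1) = 2 * (1 / (A - 1)) / ((2 * A - 1) / (A - 1))"
      by (simp only:)
    also have "\<dots> = 2 / (2 * A - 1)" using A by (simp add: divide_simps)
    finally show ?thesis .
  qed
  then have 2: "2 / (2 * A - 1) \<le> ln (1 / r)"
    using ln_ge_two_mul_diff_div_sum[of "1 / r"] r by (simp add: field_simps)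
  have "real n * (2 / (2 * A - 1)) \<le> real n * ln (1 / r)"
    by (rule mult_left_mono[OF 2]) simp
  with 1 have "real n * (2 / (2 * A - 1)) < ln (s - 1)" by linarith
  then have n_less: "real n < (A - 1 / 2) * ln (s - 1)"
    using A by (simp add: field_simps)
  have "ln (s - 1) - ln s = ln (1 - 1 / s)"
    using ln_div[of "s - 1" s] s by (simp add: diff_divide_distrib)
  also have "\<dots> \<le> - (1 / s)" using ln_add_one_self_le_self2[of "- (1 / s)"] s by simp
  finally have "1 / s \<le> ln s - ln (s - 1)" by simp
  then have "A * (1 / s) \<le> A * (ln s - ln (s - 1))" using A by (intro mult_left_mono) auto
  moreover have "2 * (1 / s) \<le> A * (1 / s)" using A s by (intro mult_right_mono) auto
  moreover have "1 - 2 * (1 / s) \<le> ln (s - 1) / 2"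
    using ln_ge_two_mul_diff_div_sum[of "s - 1"] s by (simp add: field_simps)
  ultimately show ?thesis using n_less by (simp add: algebra_simps)
qed

lemma halving_reaches_threshold:
  fixes \<tau> :: "nat \<Rightarrow> real"
  assumes "\<And>k. \<tau> (Suc k) = (1 + \<tau> k) / 2" "c < 1"
  shows "\<exists>k. c \<le> \<tau> k"
proof -
  have eq: "1 - \<tau> k = (1 - \<tau> 0) * (1 / 2) ^ k" for k
    by (induction k) (simp_all add: assms(1) field_simps)
  have "(\<lambda>k. (1 - \<tau> 0) * (1 / 2) ^ k) \<longlonglongrightarrow> (1 - \<tau> 0) * 0"
    by (intro tendsto_intros LIMSEQ_realpow_zero) auto
  then have "\<forall>\<^sub>F k in sequentially. (1 - \<tau> 0) * (1 / 2) ^ k < 1 - c"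
    using assms(2) by (intro order_tendstoD(2)) auto
  then obtain k where "(1 - \<tau> 0) * (1 / 2) ^ k < 1 - c"
    by (auto simp: eventually_sequentially)
  then show ?thesis using eq[of k] by (intro exI[of _ k]) linarith
qed

section \<open>Strong convexity and proximal points\<close>

definition strongly_convex_on :: "'a::real_inner set \<Rightarrow> real \<Rightarrow> ('a \<Rightarrow> real) \<Rightarrow> bool" where
  "strongly_convex_on D \<mu> G \<longleftrightarrow> (\<forall>x\<in>D. \<forall>y\<in>D. \<forall>t. 0 \<le> t \<and> t \<le> 1 \<longrightarrow>
     G ((1 - t) *\<^sub>R x + t *\<^sub>R y) \<le> (1 - t) * G x + t * G y - \<mu> / 2 * (t * (1 - t)) * (norm (x - y))\<^sup>2)"

lemma strongly_convex_onD:
  assumes "strongly_convex_on D \<mu> G" "x \<in> D" "y \<in> D" "0 \<le> t" "t \<le> 1"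
  shows "G ((1 - t) *\<^sub>R x + t *\<^sub>R y)
           \<le> (1 - t) * G x + t * G y - \<mu> / 2 * (t * (1 - t)) * (norm (x - y))\<^sup>2"
  using assms by (simp add: strongly_convex_on_def)

lemma strongly_convex_on_add_affine:
  assumes "strongly_convex_on D \<mu> G"
  shows "strongly_convex_on D \<mu> (\<lambda>u. a + inner g (u - c) + G u)"
  unfolding strongly_convex_on_def
proof (intro ballI allI impI)
  fix x y and t :: real assume H: "x \<in> D" "y \<in> D" "0 \<le> t \<and> t \<le> 1"
  have "inner g ((1 - t) *\<^sub>R x + t *\<^sub>R y - c) = (1 - t) * inner g (x - c) + t * inner g (y - c)"
    by (simp add: inner_diff_right inner_add_right algebra_simps)
  then show "a + inner g ((1 - t) *\<^sub>R x + t *\<^sub>R y - c) + G ((1 - t) *\<^sub>R x + t *\<^sub>R y)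
     \<le> (1 - t) * (a + inner g (x - c) + G x) + t * (a + inner g (y - c) + G y)
        - \<mu> / 2 * (t * (1 - t)) * (norm (x - y))\<^sup>2"
    using strongly_convex_onD[OF assms H(1,2), of t] H(3) by (simp add: algebra_simps)
qed

lemma strongly_convex_on_combination:
  assumes "strongly_convex_on D \<mu> G" "strongly_convex_on D \<mu> H" "0 \<le> s" "s \<le> (1::real)"
  shows "strongly_convex_on D \<mu> (\<lambda>u. s * G u + (1 - s) * H u)"
  unfolding strongly_convex_on_def
proof (intro ballI allI impI)
  fix x y and t :: real assume A: "x \<in> D" "y \<in> D" "0 \<le> t \<and> t \<le> 1"
  let ?z = "(1 - t) *\<^sub>R x + t *\<^sub>R y" and ?q = "\<mu> / 2 * (t * (1 - t)) * (norm (x - y))\<^sup>2"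
  have "s * G ?z \<le> s * ((1 - t) * G x + t * G y - ?q)"
    using strongly_convex_onD[OF assms(1) A(1,2), of t] A(3) assms(3) by (intro mult_left_mono) auto
  moreover have "(1 - s) * H ?z \<le> (1 - s) * ((1 - t) * H x + t * H y - ?q)"
    using strongly_convex_onD[OF assms(2) A(1,2), of t] A(3) assms(4) by (intro mult_left_mono) auto
  moreover have "s * ((1 - t) * G x + t * G y - ?q) + (1 - s) * ((1 - t) * H x + t * H y - ?q)
      = (1 - t) * (s * G x + (1 - s) * H x) + t * (s * G y + (1 - s) * H y) - ?q"
    by algebra
  ultimately show "s * G ?z + (1 - s) * H ?z
     \<le> (1 - t) * (s * G x + (1 - s) * H x) + t * (s * G y + (1 - s) * H y) - ?q"
    by linarith
qed

lemma norm_convex_combination_sq: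
  fixes x y c :: "'a::real_inner"
  shows "(norm ((1 - t) *\<^sub>R x + t *\<^sub>R y - c))\<^sup>2
     = (1 - t) * (norm (x - c))\<^sup>2 + t * (norm (y - c))\<^sup>2 - t * (1 - t) * (norm (x - y))\<^sup>2"
  unfolding power2_norm_eq_inner
  by (simp add: inner_diff_left inner_diff_right inner_add_left inner_add_right inner_commute
      algebra_simps)

definition prox_value :: "('a::real_inner \<Rightarrow> real) \<Rightarrow> real \<Rightarrow> 'a \<Rightarrow> 'a \<Rightarrow> real" where
  "prox_value G lam c u = G u + (norm (u - c))\<^sup>2 / (2 * lam)"

text \<open>
  The quadratic term of the proximal problem is itself strongly convex, so the moduli add up. Testing
  the minimality of \<open>x\<close> at points of the segment towards \<open>u\<close> and letting them tend to \<open>x\<close> yields the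
  growth with the full modulus.
\<close>

lemma prox_quadratic_growth:
  assumes D: "convex D" and G: "strongly_convex_on D \<mu> G" and lam: "lam > 0"
    and x: "x \<in> D" "\<And>u. u \<in> D \<Longrightarrow> prox_value G lam c x \<le> prox_value G lam c u"
    and u: "u \<in> D"
  shows "prox_value G lam c x + (\<mu> + 1 / lam) / 2 * (norm (u - x))\<^sup>2 \<le> prox_value G lam c u"
proof -
  let ?P = "prox_value G lam c" and ?s = "(\<mu> + 1 / lam) / 2 * (norm (u - x))\<^sup>2"
  have *: "?P x + (1 - t) * ?s \<le> ?P u" if t: "0 < t" "t \<le> 1" for t
  proof -
    let ?z = "(1 - t) *\<^sub>R x + t *\<^sub>R u"
    have "?z \<in> D" using D x(1) u t by (intro convexD) auto
    then have "?P x \<le> ?P ?z" by (rule x(2))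
    also have "\<dots> \<le> ((1 - t) * G x + t * G u - \<mu> / 2 * (t * (1 - t)) * (norm (x - u))\<^sup>2)
         + (norm (?z - c))\<^sup>2 / (2 * lam)"
      unfolding prox_value_def using strongly_convex_onD[OF G x(1) u, of t] t by simp
    also have "\<dots> = ?P x + t * (?P u - ?P x - (1 - t) * ?s)"
      unfolding norm_convex_combination_sq prox_value_def norm_minus_commute[of x u]
      using lam by (simp add: field_simps)
    finally have "0 \<le> t * (?P u - ?P x - (1 - t) * ?s)" by simp
    then have "0 \<le> ?P u - ?P x - (1 - t) * ?s" using t by (simp only: zero_le_mult_iff) auto
    then show ?thesis by linarith
  qed
  have "(\<lambda>n. ?P x + (1 - inverse (real (Suc n))) * ?s) \<longlonglongrightarrow> ?P x + (1 - 0) * ?s"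
    by (intro tendsto_intros LIMSEQ_inverse_real_of_nat)
  then have "?P x + (1 - 0) * ?s \<le> ?P u"
  proof (rule LIMSEQ_le_const2, intro exI[of _ 0] allI impI)
    fix n :: nat
    have "?P x + (1 - inverse (real (Suc n))) * ?s \<le> ?P u"
      by (rule *) (auto simp: inverse_le_1_iff)
    then show "?P x + (1 - inverse (real (Suc n))) * ?s \<le> ?P u" .
  qed
  then show ?thesis by simp
qed

section \<open>Real-valued estimates for one proximal step\<close>

text \<open>
  The problem restricted to the domain \<open>D\<close> of \<open>h\<close>, where all functions are real-valued.
\<close>

locale hybrid_composite =
  fixes D :: "'a::real_inner set" and f h :: "'a \<Rightarrow> real" and f' :: "'a \<Rightarrow> 'a" and M L \<mu> :: real
  assumes convex_D: "convex D"
    and h_convex: "strongly_convex_on D \<mu> h"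
    and subgradient: "\<And>x u. x \<in> D \<Longrightarrow> u \<in> D \<Longrightarrow> f x + inner (f' x) (u - x) \<le> f u"
    and hybrid: "\<And>x y. x \<in> D \<Longrightarrow> y \<in> D \<Longrightarrow> norm (f' x - f' y) \<le> 2 * M + L * norm (x - y)"
    and params: "0 \<le> M" "0 \<le> L" "0 \<le> \<mu>"
begin

definition cut :: "'a \<Rightarrow> 'a \<Rightarrow> real" where
  "cut c u = f c + inner (f' c) (u - c) + h u"

lemma cut_convex: "strongly_convex_on D \<mu> (cut c)"
  using strongly_convex_on_add_affine[OF h_convex] unfolding cut_def[abs_def] .

lemma cut_le: "c \<in> D \<Longrightarrow> u \<in> D \<Longrightarrow> cut c u \<le> f u + h u"
  using subgradient by (simp add: cut_def)

text \<open>
  For a differentiable \<open>f\<close> this follows by integrating the gradient along the segment. For a mere choice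
  of subgradients the integral is replaced by a sum: cut the segment into \<open>N\<close> pieces, bound the increase
  of \<open>f\<close> over each piece by the subgradient at its far end, and let \<open>N\<close> tend to infinity. The factor
  \<open>1 / 2\<close> in front of \<open>L\<close>, which the constants in \<open>t_bar\<close> rely on, is the limit of
  \<open>(1 + 2 + \<dots> + N) / N\<^sup>2\<close>.
\<close>

lemma upper_model:
  assumes x: "x \<in> D" and u: "u \<in> D"
  shows "f u \<le> f x + inner (f' x) (u - x) + 2 * M * norm (u - x) + L / 2 * (norm (u - x))\<^sup>2"
proof -
  let ?d = "u - x" and ?\<delta> = "norm (u - x)"
  have *: "f u \<le> f x + inner (f' x) ?d + 2 * M * ?\<delta> + L / 2 * ?\<delta>\<^sup>2 * (1 + inverse (real (Suc k)))"
    for k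
  proof -
    define N where "N = real (Suc k)"
    have N: "N > 0" by (simp add: N_def)
    define z where "z j = x + (real j / N) *\<^sub>R ?d" for j
    have zD: "z j \<in> D" if "j \<le> Suc k" for j
    proof -
      have "z j = (1 - real j / N) *\<^sub>R x + (real j / N) *\<^sub>R u"
        by (simp add: z_def algebra_simps)
      also have "\<dots> \<in> D" using that N by (intro convexD[OF convex_D x u]) (auto simp: N_def)
      finally show ?thesis .
    qed
    have "f (z j) \<le> f x + real j / N * (inner (f' x) ?d + 2 * M * ?\<delta>)
            + L * ?\<delta>\<^sup>2 * (real j * (real j + 1) / (2 * N\<^sup>2))" if "j \<le> Suc k" for j
      using that
    proof (induction j)
      case 0
      then show ?case by (simp add: z_def)
    next
      case (Suc j)
      let ?y = "z (Suc j)"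
      have diff: "z j - ?y = - (1 / N) *\<^sub>R ?d"
        by (simp add: z_def algebra_simps add_divide_distrib)
      have "f ?y + inner (f' ?y) (z j - ?y) \<le> f (z j)"
        using Suc.prems by (intro subgradient zD) auto
      then have 1: "f ?y \<le> f (z j) + 1 / N * inner (f' ?y) ?d" unfolding diff by simp
      have "norm (f' ?y - f' x) \<le> 2 * M + L * norm (?y - x)"
        using Suc.prems x by (intro hybrid zD) auto
      also have "norm (?y - x) = (real j + 1) / N * ?\<delta>"
        using N by (simp add: z_def add.commute)
      finally have "norm (f' ?y - f' x) * ?\<delta> \<le> (2 * M + L * ((real j + 1) / N * ?\<delta>)) * ?\<delta>"
        by (rule mult_right_mono) simp
      then have "inner (f' ?y - f' x) ?d \<le> (2 * M + L * ((real j + 1) / N * ?\<delta>)) * ?\<delta>"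
        using norm_cauchy_schwarz[of "f' ?y - f' x" ?d] by linarith
      then have "inner (f' ?y) ?d \<le> inner (f' x) ?d + 2 * M * ?\<delta> + L * ?\<delta>\<^sup>2 * ((real j + 1) / N)"
        by (simp add: inner_diff_left algebra_simps power2_eq_square)
      then have "1 / N * inner (f' ?y) ?d
          \<le> 1 / N * (inner (f' x) ?d + 2 * M * ?\<delta> + L * ?\<delta>\<^sup>2 * ((real j + 1) / N))"
        using N by (intro mult_left_mono) auto
      with 1 Suc.IH Suc.prems have "f ?y \<le> f x + real j / N * (inner (f' x) ?d + 2 * M * ?\<delta>)
          + L * ?\<delta>\<^sup>2 * (real j * (real j + 1) / (2 * N\<^sup>2))
          + 1 / N * (inner (f' x) ?d + 2 * M * ?\<delta> + L * ?\<delta>\<^sup>2 * ((real j + 1) / N))"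
        by simp
      also have "\<dots> = f x + real (Suc j) / N * (inner (f' x) ?d + 2 * M * ?\<delta>)
            + L * ?\<delta>\<^sup>2 * (real (Suc j) * (real (Suc j) + 1) / (2 * N\<^sup>2))"
        using N by (simp add: field_simps power2_eq_square)
      finally show ?case .
    qed
    from this[of "Suc k"]
    have "f (z (Suc k)) \<le> f x + N / N * (inner (f' x) ?d + 2 * M * ?\<delta>)
        + L * ?\<delta>\<^sup>2 * (N * (N + 1) / (2 * N\<^sup>2))" by (simp add: N_def)
    moreover have "z (Suc k) = u" unfolding z_def N_def[symmetric] using N by simp
    moreover have "N * (N + 1) / (2 * N\<^sup>2) = (1 + inverse N) / 2"
      using N by (simp add: field_simps power2_eq_square)
    ultimately have "f u \<le> f x + 1 * (inner (f' x) ?d + 2 * M * ?\<delta>)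
        + L * ?\<delta>\<^sup>2 * ((1 + inverse N) / 2)" using N by (simp only: divide_self)
    then show ?thesis unfolding N_def[symmetric] by (simp add: algebra_simps)
  qed
  have "(\<lambda>k. f x + inner (f' x) ?d + 2 * M * ?\<delta> + L / 2 * ?\<delta>\<^sup>2 * (1 + inverse (real (Suc k))))
     \<longlonglongrightarrow> f x + inner (f' x) ?d + 2 * M * ?\<delta> + L / 2 * ?\<delta>\<^sup>2 * (1 + 0)"
    by (intro tendsto_intros LIMSEQ_inverse_real_of_nat)
  from LIMSEQ_le_const[OF this, of "f u"] * show ?thesis by auto
qed

text \<open>
  In the new proximal value the old model contributes quadratic growth with weight \<open>\<tau>\<close>, while the new
  cut, with weight \<open>1 - \<tau>\<close>, underestimates \<open>\<phi>\<close> by at most \<open>2 * M * \<delta> + L / 2 * \<delta>\<^sup>2\<close>, where \<open>\<delta>\<close> is the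
  distance between the two proximal points. By the inequality of arithmetic and geometric means this
  error is at most \<open>\<epsilon> / 4 + 4 * (M\<^sup>2 + \<epsilon> * L) / \<epsilon> * \<delta>\<^sup>2\<close>, and for \<open>\<tau> \<ge> 1 - 2 / A\<close> the growth absorbs the
  part with \<open>\<delta>\<^sup>2\<close>.
\<close>

lemma null_step_gap:
  assumes lam: "lam > 0" and eps: "\<epsilon> > 0"
    and A: "A = 2 * (1 + 8 * (lam / (1 + lam * \<mu>)) * (M\<^sup>2 + \<epsilon> * L) / \<epsilon>)"
    and tau: "1 - 2 / A \<le> \<tau>" "0 \<le> \<tau>" "\<tau> \<le> 1"
    and G: "strongly_convex_on D \<mu> G"
    and x: "x \<in> D" "\<And>u. u \<in> D \<Longrightarrow> prox_value G lam c x \<le> prox_value G lam c u"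
    and x': "x' \<in> D"
    and p: "p' \<le> p" "p' \<le> f x' + h x'"
  shows "p' - prox_value (\<lambda>u. \<tau> * G u + (1 - \<tau>) * cut x u) lam c x'
           \<le> \<tau> * (p - prox_value G lam c x) + (1 - \<tau>) * \<epsilon> / 4"
proof -
  define \<delta> where "\<delta> = norm (x' - x)"
  define \<sigma> where "\<sigma> = \<mu> + 1 / lam"
  define T where "T = M\<^sup>2 + \<epsilon> * L"
  define W where "W = 8 * T / (\<sigma> * \<epsilon>)"
  have \<sigma>: "\<sigma> > 0" using lam params by (simp add: \<sigma>_def add_nonneg_pos)
  have T: "T \<ge> 0" using eps params by (simp add: T_def)
  have W: "W \<ge> 0" using T \<sigma> eps by (simp add: W_def)
  have "lam / (1 + lam * \<mu>) = 1 / \<sigma>" using lam by (simp add: \<sigma>_def field_simps)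
  then have A': "A = 2 * (1 + W)" unfolding A W_def T_def[symmetric] by simp
  \<comment> \<open>The threshold on \<open>\<tau>\<close> is chosen such that \<open>\<tau> / (1 - \<tau>) \<ge> W\<close>.\<close>
  have "A * (1 - 2 / A) \<le> A * \<tau>" using tau(1) W A' by (intro mult_left_mono) auto
  moreover have "A * (1 - 2 / A) = A - 2" using W unfolding A' by (simp add: field_simps)
  ultimately have "A - 2 \<le> A * \<tau>" by simp
  then have "W * (1 - \<tau>) \<le> \<tau>" unfolding A' by (simp add: algebra_simps)
  then have "W * (1 - \<tau>) * (\<sigma> / 2 * \<delta>\<^sup>2) \<le> \<tau> * (\<sigma> / 2 * \<delta>\<^sup>2)"
    using \<sigma> by (intro mult_right_mono) auto
  moreover have "W * (1 - \<tau>) * (\<sigma> / 2 * \<delta>\<^sup>2) = (1 - \<tau>) * (4 * T / \<epsilon> * \<delta>\<^sup>2)"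
    using \<sigma> eps by (simp add: W_def field_simps)
  ultimately have prox_gain: "(1 - \<tau>) * (4 * T / \<epsilon> * \<delta>\<^sup>2) \<le> \<tau> * (\<sigma> / 2 * \<delta>\<^sup>2)" by simp
  have "2 * M * \<delta> + L / 2 * \<delta>\<^sup>2 \<le> 4 * T / \<epsilon> * \<delta>\<^sup>2 + \<epsilon> / 4"
  proof -
    \<comment> \<open>\<open>2 * M * \<delta>\<close> is twice the product of \<open>2 * M * \<delta> / sqrt \<epsilon>\<close> and \<open>sqrt \<epsilon> / 2\<close>.\<close>
    have "0 \<le> (4 * M * \<delta> - \<epsilon>)\<^sup>2 / (4 * \<epsilon>)" using eps by simp
    also have "\<dots> = 4 * M\<^sup>2 / \<epsilon> * \<delta>\<^sup>2 - 2 * M * \<delta> + \<epsilon> / 4"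
      using eps by (simp add: field_simps power2_eq_square)
    finally have "2 * M * \<delta> \<le> 4 * M\<^sup>2 / \<epsilon> * \<delta>\<^sup>2 + \<epsilon> / 4" by simp
    moreover have "4 * T / \<epsilon> * \<delta>\<^sup>2 = 4 * M\<^sup>2 / \<epsilon> * \<delta>\<^sup>2 + 4 * (L * \<delta>\<^sup>2)"
      using eps by (simp add: T_def field_simps)
    moreover have "0 \<le> L * \<delta>\<^sup>2" using params by simp
    ultimately show ?thesis by simp
  qed
  then have err: "(1 - \<tau>) * (2 * M * \<delta> + L / 2 * \<delta>\<^sup>2) \<le> (1 - \<tau>) * (4 * T / \<epsilon> * \<delta>\<^sup>2 + \<epsilon> / 4)"
    using tau by (intro mult_left_mono) auto
  have "prox_value G lam c x + \<sigma> / 2 * \<delta>\<^sup>2 \<le> prox_value G lam c x'"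
    using prox_quadratic_growth[OF convex_D G lam x x'] by (simp add: \<sigma>_def \<delta>_def)
  then have 1: "\<tau> * (prox_value G lam c x + \<sigma> / 2 * \<delta>\<^sup>2) \<le> \<tau> * prox_value G lam c x'"
    using tau by (intro mult_left_mono) auto
  have "f x' + h x' - (2 * M * \<delta> + L / 2 * \<delta>\<^sup>2) \<le> cut x x' + (norm (x' - c))\<^sup>2 / (2 * lam)"
    using upper_model[OF x(1) x'] lam by (simp add: cut_def \<delta>_def add_increasing2)
  then have "p' - (2 * M * \<delta> + L / 2 * \<delta>\<^sup>2) \<le> cut x x' + (norm (x' - c))\<^sup>2 / (2 * lam)"
    using p by linarith
  then have 2: "(1 - \<tau>) * (p' - (2 * M * \<delta> + L / 2 * \<delta>\<^sup>2))
      \<le> (1 - \<tau>) * (cut x x' + (norm (x' - c))\<^sup>2 / (2 * lam))"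
    using tau by (intro mult_left_mono) auto
  have 3: "prox_value (\<lambda>u. \<tau> * G u + (1 - \<tau>) * cut x u) lam c x'
      = \<tau> * prox_value G lam c x' + (1 - \<tau>) * (cut x x' + (norm (x' - c))\<^sup>2 / (2 * lam))"
    using lam by (simp add: prox_value_def field_simps)
  have 4: "\<tau> * p' \<le> \<tau> * p" using p tau by (intro mult_left_mono) auto
  have combine: "b - (t * q + (1 - t) * y) \<le> t * (a - m) + (1 - t) * z / 4"
    if "t * (m + g) \<le> t * q" "(1 - t) * (b - e) \<le> (1 - t) * y" "t * b \<le> t * a"
      "(1 - t) * k \<le> t * g" "(1 - t) * e \<le> (1 - t) * (k + z / 4)"
    for t m g q a b e y k z :: real
  proof -
    have "(1 - t) * b - (1 - t) * e \<le> (1 - t) * y" "(1 - t) * e \<le> (1 - t) * k + (1 - t) * z / 4"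
      "t * m + t * g \<le> t * q" "(1 - t) * b = b - t * b" "t * (a - m) = t * a - t * m"
      using that by (simp_all only: distrib_left right_diff_distrib left_diff_distrib mult_1
          times_divide_eq_right)
    then show ?thesis using that(3,4) by linarith
  qed
  show ?thesis unfolding 3 by (rule combine[OF 1 2 4 prox_gain err])
qed

text \<open>
  Left minus right side of the hypothesis is a concave function of \<open>d\<close> (\<open>F\<close> below is twice it), so if
  it is positive at \<open>d = 0\<close> and at \<open>d = R\<close>, then it is positive in between. If the conclusion failed, then
  \<open>r > 14 / 5 * (R + q)\<close> (as \<open>14 / 5 < sqrt 8\<close>), which makes both end values positive.
\<close>

lemma step_length_arithmetic:
  fixes r d R q :: real
  assumes "0 \<le> d" "d \<le> R" "0 \<le> q" "0 \<le> r"
    and main: "2 * r\<^sup>2 - 2 * r * d \<le> 4 * q * (r + R - d) + (r + R - d)\<^sup>2 / 2"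
  shows "r\<^sup>2 \<le> 8 * (R + q)\<^sup>2"
proof (rule ccontr)
  assume neg: "\<not> r\<^sup>2 \<le> 8 * (R + q)\<^sup>2"
  have big: "14 * R + 14 * q < 5 * r"
  proof (rule ccontr)
    assume "\<not> 14 * R + 14 * q < 5 * r"
    then have "r \<le> 14 / 5 * (R + q)" by simp
    then have "r\<^sup>2 \<le> (14 / 5 * (R + q))\<^sup>2" using assms by (intro power_mono) auto
    also have "\<dots> = 196 / 25 * (R + q)\<^sup>2"
      by (simp only: power_mult_distrib) (simp add: power2_eq_square)
    also have "\<dots> \<le> 8 * (R + q)\<^sup>2" by (intro mult_right_mono) auto
    finally show False using neg by simp
  qed
  have r: "r > 0" using big assms(1-3) by linarith
  define F where "F z = 4 * r\<^sup>2 - 4 * r * z - 8 * q * (r + R - z) - (r + R - z)\<^sup>2" for z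
  have FR: "F R > 0"
  proof -
    have "F R = r * (3 * r - 4 * R - 8 * q)" by (simp add: F_def power2_eq_square algebra_simps)
    moreover have "3 * r - 4 * R - 8 * q > 0" using big assms(1-3) by linarith
    ultimately show ?thesis using r by simp
  qed
  have F0: "F 0 > 0"
  proof -
    have "F 0 = r * (3 * r - 2 * R - 8 * q) - 8 * q * R - R\<^sup>2"
      by (simp add: F_def power2_eq_square algebra_simps)
    moreover have "r * (6 * R) < r * (3 * r - 2 * R - 8 * q)"
      using big assms(1-3) r by (intro mult_strict_left_mono) linarith+
    moreover have "(2 * R + 2 * q) * (6 * R) \<le> r * (6 * R)"
      using big assms(1-3) by (intro mult_right_mono) linarith+
    moreover have "(2 * R + 2 * q) * (6 * R) - 8 * q * R - R\<^sup>2 = 11 * R\<^sup>2 + 4 * (q * R)"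
      by (simp add: power2_eq_square algebra_simps)
    moreover have "0 \<le> 11 * R\<^sup>2 + 4 * (q * R)" using assms(1-3) by simp
    ultimately show ?thesis by linarith
  qed
  have "F d = 2 * ((2 * r\<^sup>2 - 2 * r * d) - (4 * q * (r + R - d) + (r + R - d)\<^sup>2 / 2))"
    by (simp add: F_def)
  also have "\<dots> \<le> 0"
    by (rule mult_nonneg_nonpos) (use main in \<open>simp_all only: diff_le_0_iff_le zero_le_numeral\<close>)
  finally have "F d \<le> 0" .
  show False
  proof (cases "R = 0")
    case True
    then show False using F0 \<open>F d \<le> 0\<close> assms by simp
  next
    case False
    have "R * F d = (R - d) * F 0 + d * F R + R * (d * (R - d))"
      by (simp add: F_def power2_eq_square algebra_simps)
    moreover have "R * (d * (R - d)) \<ge> 0" using assms by simp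
    moreover have "(R - d) * F 0 + d * F R > 0"
    proof (cases "d = R")
      case True
      then show ?thesis using FR assms False by simp
    next
      case F: False
      then have "(R - d) * F 0 > 0" using F0 assms by simp
      moreover have "d * F R \<ge> 0" using FR assms by simp
      ultimately show ?thesis by linarith
    qed
    ultimately have "R * F d > 0" by linarith
    then show False using \<open>F d \<le> 0\<close> assms False by (simp add: zero_less_mult_iff)
  qed
qed

text \<open>
  For \<open>2 * lam * L \<le> 1\<close> one compares the minimal value \<open>cut c x\<close> with the lower bound on the cut that
  \<open>upper_model\<close> and the optimality of \<open>xs\<close> provide. For a longer stepsize the term \<open>L / 2 * r\<^sup>2\<close> in that
  lower bound is too large at \<open>x\<close>. The comparison is therefore made at the point
  \<open>w = (1 - s) xs + s x\<close> with \<open>s = 1 / max 1 (2 * lam * L)\<close>: by convexity the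
  cut at \<open>w\<close> still lies below the optimal value by the fraction \<open>s\<close>, whereas the quadratic error shrinks
  like \<open>s\<^sup>2\<close>.
\<close>

lemma serious_step_length:
  assumes lam: "lam > 0" and c: "c \<in> D"
    and xs: "xs \<in> D" "\<And>u. u \<in> D \<Longrightarrow> f xs + h xs \<le> f u + h u"
    and x: "x \<in> D" "\<And>u. u \<in> D \<Longrightarrow> prox_value (cut c) lam c x \<le> prox_value (cut c) lam c u"
  shows "(norm (x - c))\<^sup>2 \<le> 8 * (max 1 (2 * lam * L) * norm (c - xs) + lam * M)\<^sup>2"
proof -
  define \<alpha> where "\<alpha> = max 1 (2 * lam * L)"
  define s where "s = 1 / \<alpha>"
  define r where "r = norm (x - c)"
  define d where "d = norm (c - xs)"
  define e where "e = norm (xs - x)"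
  define w where "w = (1 - s) *\<^sub>R xs + s *\<^sub>R x"
  define W where "W = norm (w - c)"
  define P where "P = f xs + h xs"
  have \<alpha>: "\<alpha> \<ge> 1" "2 * lam * L \<le> \<alpha>" by (auto simp: \<alpha>_def)
  have s: "0 < s" "s \<le> 1" "\<alpha> * s = 1" using \<alpha> by (auto simp: s_def)
  have wD: "w \<in> D" unfolding w_def using s by (intro convexD[OF convex_D xs(1) x(1)]) auto
  have "cut c x + r\<^sup>2 / (2 * lam) + (\<mu> + 1 / lam) / 2 * e\<^sup>2 \<le> cut c xs + d\<^sup>2 / (2 * lam)"
    using prox_quadratic_growth[OF convex_D cut_convex lam x xs(1)]
    by (simp add: prox_value_def r_def d_def e_def norm_minus_commute[of c xs])
  moreover have "(1 / lam) / 2 * e\<^sup>2 \<le> (\<mu> + 1 / lam) / 2 * e\<^sup>2"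
    using params by (intro mult_right_mono divide_right_mono) auto
  moreover have "cut c xs \<le> P" using cut_le[OF c xs(1)] by (simp add: P_def)
  ultimately have "cut c x \<le> P - (r\<^sup>2 / (2 * lam) + 1 / lam / 2 * e\<^sup>2 - d\<^sup>2 / (2 * lam))" by linarith
  also have "r\<^sup>2 / (2 * lam) + 1 / lam / 2 * e\<^sup>2 - d\<^sup>2 / (2 * lam) = (r\<^sup>2 + e\<^sup>2 - d\<^sup>2) / (2 * lam)"
    using lam by (simp add: field_simps)
  finally have cut_x: "cut c x \<le> P - (r\<^sup>2 + e\<^sup>2 - d\<^sup>2) / (2 * lam)" .
  have "cut c w \<le> (1 - s) * cut c xs + s * cut c x"
  proof -
    have "0 \<le> \<mu> / 2 * (s * (1 - s)) * (norm (xs - x))\<^sup>2" using params s by simp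
    then show ?thesis
      using strongly_convex_onD[OF cut_convex[of c] xs(1) x(1), of s] s unfolding w_def by linarith
  qed
  also have "\<dots> \<le> (1 - s) * P + s * (P - (r\<^sup>2 + e\<^sup>2 - d\<^sup>2) / (2 * lam))"
    using cut_x \<open>cut c xs \<le> P\<close> s by (intro add_mono mult_left_mono) auto
  finally have "cut c w \<le> P - s * ((r\<^sup>2 + e\<^sup>2 - d\<^sup>2) / (2 * lam))" by (simp add: algebra_simps)
  moreover have "P - (2 * M * W + L / 2 * W\<^sup>2) \<le> cut c w"
    using upper_model[OF c wD] xs(2)[OF wD] by (simp add: cut_def W_def P_def)
  ultimately have "s * ((r\<^sup>2 + e\<^sup>2 - d\<^sup>2) / (2 * lam)) \<le> 2 * M * W + L / 2 * W\<^sup>2" by linarith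
  then have "2 * lam * \<alpha> * (s * ((r\<^sup>2 + e\<^sup>2 - d\<^sup>2) / (2 * lam))) \<le> 2 * lam * \<alpha> * (2 * M * W + L / 2 * W\<^sup>2)"
    using lam \<alpha> by (intro mult_left_mono) auto
  moreover have "2 * lam * \<alpha> * (s * ((r\<^sup>2 + e\<^sup>2 - d\<^sup>2) / (2 * lam))) = (\<alpha> * s) * (r\<^sup>2 + e\<^sup>2 - d\<^sup>2)"
    using lam by simp
  moreover have "2 * lam * \<alpha> * (2 * M * W + L / 2 * W\<^sup>2)
      = 4 * (lam * M) * (\<alpha> * W) + (2 * lam * L) * (\<alpha> * W\<^sup>2) / 2"
    by (simp add: algebra_simps)
  moreover have "(2 * lam * L) * (\<alpha> * W\<^sup>2) \<le> \<alpha> * (\<alpha> * W\<^sup>2)"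
    using \<alpha> by (intro mult_right_mono) auto
  moreover have "\<alpha> * (\<alpha> * W\<^sup>2) = (\<alpha> * W)\<^sup>2" by (simp add: power2_eq_square)
  ultimately have 1: "r\<^sup>2 + e\<^sup>2 - d\<^sup>2 \<le> 4 * (lam * M) * (\<alpha> * W) + (\<alpha> * W)\<^sup>2 / 2"
    using s by simp
  have "w - c = (1 - s) *\<^sub>R (xs - c) + s *\<^sub>R (x - c)" by (simp add: w_def algebra_simps)
  then have "W \<le> (1 - s) * d + s * r"
    unfolding W_def using norm_triangle_ineq[of "(1 - s) *\<^sub>R (xs - c)" "s *\<^sub>R (x - c)"] s
    by (simp add: d_def r_def norm_minus_commute)
  then have "\<alpha> * W \<le> \<alpha> * ((1 - s) * d + s * r)" using \<alpha> by (intro mult_left_mono) auto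
  also have "\<dots> = \<alpha> * d - (\<alpha> * s) * d + (\<alpha> * s) * r" by (simp add: algebra_simps)
  finally have U: "\<alpha> * W \<le> r + \<alpha> * d - d" using s by simp
  have W0: "0 \<le> \<alpha> * W" using \<alpha> by (simp add: W_def)
  \<comment> \<open>Bounding \<open>e\<close> from below in terms of \<open>r\<close> and \<open>d\<close> leaves an inequality between \<open>r\<close> and \<open>d\<close> alone.\<close>
  have "\<bar>r - d\<bar> \<le> e"
    unfolding r_def d_def e_def
    using norm_triangle_ineq3[of "x - c" "xs - c"] by (simp add: norm_minus_commute)
  then have "(r - d)\<^sup>2 \<le> e\<^sup>2" using power_mono[of "\<bar>r - d\<bar>" e 2] by simp
  then have "2 * r\<^sup>2 - 2 * r * d \<le> r\<^sup>2 + e\<^sup>2 - d\<^sup>2" by (simp add: power2_eq_square algebra_simps)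
  also note 1
  also have "4 * (lam * M) * (\<alpha> * W) + (\<alpha> * W)\<^sup>2 / 2
      \<le> 4 * (lam * M) * (r + \<alpha> * d - d) + (r + \<alpha> * d - d)\<^sup>2 / 2"
    using U W0 lam params by (intro add_mono mult_left_mono divide_right_mono power_mono) auto
  finally have "r\<^sup>2 \<le> 8 * (\<alpha> * d + lam * M)\<^sup>2"
    using \<alpha> lam params
    by (intro step_length_arithmetic[of d])
       (auto simp: d_def r_def intro: mult_right_mono[of 1 \<alpha> "norm (c - xs)", simplified])
  then show ?thesis by (simp add: r_def d_def \<alpha>_def)
qed

text \<open>
  The first model of a cycle is a single cut, so the first gap is at most the linearization error of
  that cut over one proximal step, and \<open>2 * M * r \<le> M\<^sup>2 + r\<^sup>2\<close> puts it into the form of \<open>t_bar\<close>.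
\<close>

lemma serious_step_gap:
  assumes lam: "lam > 0" and c: "c \<in> D"
    and xs: "xs \<in> D" "\<And>u. u \<in> D \<Longrightarrow> f xs + h xs \<le> f u + h u"
    and x: "x \<in> D" "\<And>u. u \<in> D \<Longrightarrow> prox_value (cut c) lam c x \<le> prox_value (cut c) lam c u"
    and d: "norm (c - xs) \<le> d"
  shows "f x + h x - prox_value (cut c) lam c x
           \<le> M\<^sup>2 + 4 * (L + 2) * (max 1 (2 * lam * L) * d + lam * M)\<^sup>2"
proof -
  define r where "r = norm (x - c)"
  have "r\<^sup>2 \<le> 8 * (max 1 (2 * lam * L) * norm (c - xs) + lam * M)\<^sup>2"
    unfolding r_def by (rule serious_step_length[OF assms(1-6)])
  also have "\<dots> \<le> 8 * (max 1 (2 * lam * L) * d + lam * M)\<^sup>2"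
    using d lam params by (intro mult_left_mono power_mono add_mono) auto
  finally have "(L + 2) / 2 * r\<^sup>2 \<le> (L + 2) / 2 * (8 * (max 1 (2 * lam * L) * d + lam * M)\<^sup>2)"
    using params by (intro mult_left_mono) auto
  moreover have "f x + h x - prox_value (cut c) lam c x \<le> 2 * M * r + L / 2 * r\<^sup>2 - r\<^sup>2 / (2 * lam)"
    using upper_model[OF c x(1)] by (simp add: prox_value_def cut_def r_def)
  moreover have "0 \<le> r\<^sup>2 / (2 * lam)" using lam by simp
  moreover have "2 * M * r \<le> M\<^sup>2 + r\<^sup>2" using zero_le_power2[of "M - r"]
    by (simp add: power2_eq_square algebra_simps)
  moreover have "L / 2 * r\<^sup>2 + r\<^sup>2 = (L + 2) / 2 * r\<^sup>2" by (simp add: algebra_simps)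
  ultimately show ?thesis by linarith
qed

text \<open>
  The end of a cycle: the model minorizes the objective at \<open>xs\<close>, its minimal proximal value is within
  \<open>\<epsilon> / 2\<close> of \<open>p\<close>, and \<open>p\<close> is still more than \<open>\<epsilon>\<close> above the optimal value. So \<open>\<epsilon> / 2\<close> is left over to push
  the proximal point towards \<open>xs\<close>.
\<close>

lemma serious_step_decrease:
  assumes lam: "lam > 0"
    and G: "strongly_convex_on D \<mu> G" "\<And>u. u \<in> D \<Longrightarrow> G u \<le> f u + h u"
    and x: "x \<in> D" "\<And>u. u \<in> D \<Longrightarrow> prox_value G lam c x \<le> prox_value G lam c u"
    and xs: "xs \<in> D"
    and gap: "p - prox_value G lam c x \<le> \<epsilon> / 2" and p: "f xs + h xs + \<epsilon> < p"
  shows "(1 + lam * \<mu>) * (norm (x - xs))\<^sup>2 + lam * \<epsilon> \<le> (norm (c - xs))\<^sup>2"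
proof -
  have "prox_value G lam c x + (\<mu> + 1 / lam) / 2 * (norm (x - xs))\<^sup>2
      \<le> f xs + h xs + (norm (c - xs))\<^sup>2 / (2 * lam)"
    using prox_quadratic_growth[OF convex_D G(1) lam x xs] G(2)[OF xs]
    by (simp add: prox_value_def norm_minus_commute)
  then have "\<epsilon> / 2 + (\<mu> + 1 / lam) / 2 * (norm (x - xs))\<^sup>2 \<le> (norm (c - xs))\<^sup>2 / (2 * lam)"
    using gap p by linarith
  then have "2 * lam * (\<epsilon> / 2 + (\<mu> + 1 / lam) / 2 * (norm (x - xs))\<^sup>2)
      \<le> 2 * lam * ((norm (c - xs))\<^sup>2 / (2 * lam))"
    using lam by (intro mult_left_mono) auto
  moreover have "2 * lam * (\<epsilon> / 2 + (\<mu> + 1 / lam) / 2 * (norm (x - xs))\<^sup>2)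
      = (1 + lam * \<mu>) * (norm (x - xs))\<^sup>2 + lam * \<epsilon>" using lam by (simp add: field_simps)
  ultimately show ?thesis using lam by simp
qed

end

section \<open>Counting the cycles\<close>

text \<open>
  The recursion \<open>(1 + lam * \<mu>) * r' + lam * \<epsilon> \<le> r\<close> unrolled \<open>K\<close> times from \<open>R\<close>, where \<open>R\<close> and \<open>r\<close> are
  squared distances. The first conjunct drops the factor \<open>1 + lam * \<mu>\<close>. The second records that
  \<open>r + \<epsilon> / \<mu>\<close> decays geometrically; multiplying by \<open>\<mu>\<close> makes it meaningful for \<open>\<mu> = 0\<close> as well.
\<close>

definition serious_progress :: "real \<Rightarrow> real \<Rightarrow> real \<Rightarrow> real \<Rightarrow> nat \<Rightarrow> real \<Rightarrow> bool" where
  "serious_progress lam \<mu> \<epsilon> R K r \<longleftrightarrow>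
     r + real K * (lam * \<epsilon>) \<le> R \<and> (1 + lam * \<mu>) ^ K * (\<mu> * r + \<epsilon>) \<le> \<mu> * R + \<epsilon>"

lemma serious_progress_Suc:
  assumes "serious_progress lam \<mu> \<epsilon> R K r" and step: "(1 + lam * \<mu>) * r' + lam * \<epsilon> \<le> r"
    and nonneg: "0 \<le> r'" "0 \<le> lam" "0 \<le> \<mu>"
  shows "serious_progress lam \<mu> \<epsilon> R (Suc K) r'"
proof -
  have lin: "r' + lam * \<epsilon> \<le> r"
  proof -
    have "0 \<le> lam * \<mu> * r'" using nonneg by simp
    then show ?thesis using step by (simp add: algebra_simps)
  qed
  have "(1 + lam * \<mu>) * (\<mu> * r' + \<epsilon>) = \<mu> * ((1 + lam * \<mu>) * r' + lam * \<epsilon>) + \<epsilon>"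
    by (simp add: algebra_simps)
  also have "\<dots> \<le> \<mu> * r + \<epsilon>" using step nonneg by (intro add_right_mono mult_left_mono) auto
  finally have "(1 + lam * \<mu>) ^ K * ((1 + lam * \<mu>) * (\<mu> * r' + \<epsilon>)) \<le> (1 + lam * \<mu>) ^ K * (\<mu> * r + \<epsilon>)"
    using nonneg by (intro mult_left_mono) auto
  also have "\<dots> \<le> \<mu> * R + \<epsilon>" using assms(1) by (simp add: serious_progress_def)
  finally have "(1 + lam * \<mu>) ^ Suc K * (\<mu> * r' + \<epsilon>) \<le> \<mu> * R + \<epsilon>"
    by (simp only: power_Suc2 mult.assoc)
  moreover have "r' + real (Suc K) * (lam * \<epsilon>) \<le> R"
    using assms(1) lin by (simp add: serious_progress_def algebra_simps)
  ultimately show ?thesis by (simp add: serious_progress_def)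
qed

definition cycle_bound :: "real \<Rightarrow> real \<Rightarrow> real \<Rightarrow> real \<Rightarrow> real" where
  "cycle_bound lam \<mu> \<epsilon> d = (if \<mu> = 0 then d\<^sup>2 / (lam * \<epsilon>)
     else min (d\<^sup>2 / (lam * \<epsilon>)) (1 / (\<mu> * lambda_mu lam \<mu>) * ln (\<mu> * d\<^sup>2 / \<epsilon> + 1)))"

lemma serious_progress_count:
  assumes prog: "serious_progress lam \<mu> \<epsilon> (d\<^sup>2) K r"
    and pos: "0 \<le> r" "0 < lam" "0 \<le> \<mu>" "0 < \<epsilon>"
  shows "real K \<le> cycle_bound lam \<mu> \<epsilon> d"
proof -
  have "real K * (lam * \<epsilon>) \<le> d\<^sup>2" using prog pos by (simp add: serious_progress_def)
  then have lin: "real K \<le> d\<^sup>2 / (lam * \<epsilon>)" using pos by (simp add: pos_le_divide_eq)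
  have "real K \<le> 1 / (\<mu> * lambda_mu lam \<mu>) * ln (\<mu> * d\<^sup>2 / \<epsilon> + 1)" if "\<mu> \<noteq> 0"
  proof -
    define z where "z = lam * \<mu>"
    have z: "z > 0" using that pos by (simp add: z_def)
    have mul: "\<mu> * lambda_mu lam \<mu> = z / (1 + z)" by (simp add: lambda_mu_def z_def)
    have "(1 + z) ^ K * \<epsilon> \<le> (1 + z) ^ K * (\<mu> * r + \<epsilon>)"
      using z pos by (intro mult_left_mono) auto
    also have "\<dots> \<le> \<mu> * d\<^sup>2 + \<epsilon>" using prog by (simp add: serious_progress_def z_def)
    finally have "(1 + z) ^ K \<le> \<mu> * d\<^sup>2 / \<epsilon> + 1" using pos by (simp add: field_simps)
    then have "ln ((1 + z) ^ K) \<le> ln (\<mu> * d\<^sup>2 / \<epsilon> + 1)"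
      using z by (smt (verit) ln_mono zero_less_power)
    then have 1: "real K * ln (1 + z) \<le> ln (\<mu> * d\<^sup>2 / \<epsilon> + 1)" using z by (simp add: ln_realpow)
    have "ln (1 / (1 + z)) \<le> 1 / (1 + z) - 1" using z by (intro ln_le_minus_one) simp
    also have "\<dots> = - (z / (1 + z))" using z by (simp add: field_simps)
    finally have "z / (1 + z) \<le> ln (1 + z)" using z by (simp add: ln_div)
    then have "real K * (z / (1 + z)) \<le> real K * ln (1 + z)" by (intro mult_left_mono) auto
    with 1 have "real K * (z / (1 + z)) \<le> ln (\<mu> * d\<^sup>2 / \<epsilon> + 1)" by linarith
    moreover have "z / (1 + z) > 0" using z by simp
    ultimately have "real K \<le> ln (\<mu> * d\<^sup>2 / \<epsilon> + 1) / (z / (1 + z))"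
      by (simp only: pos_le_divide_eq)
    then show ?thesis unfolding mul by (simp add: mult.commute)
  qed
  with lin show ?thesis by (simp add: cycle_bound_def)
qed

section \<open>From extended to real values\<close>

text \<open>
  With \<open>xs\<close> an arbitrary optimal point and \<open>(M, L)\<close> an arbitrary admissible pair, the analysis of the
  method stays independent of the existence of a nearest optimal point and of a best pair, and of the
  dimension of the space.
\<close>

locale apb_instance =
  fixes V :: "'a::real_inner set" and f h :: "'a \<Rightarrow> ereal" and f' :: "'a \<Rightarrow> 'a"
    and M L \<mu> :: real and x0 xs :: 'a and lam \<beta> \<epsilon> :: real
  assumes convex_V: "convex V"
    and problem: "problem_assms V f f' h M L \<mu>"
    and xs_opt: "xs \<in> opt_set V f h"
    and x0_dom: "x0 \<in> edom V h"
    and lam_pos: "lam > 0" and beta_ge: "\<beta> \<ge> 1" and eps_pos: "\<epsilon> > 0"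
begin

abbreviation D :: "'a set" where "D \<equiv> edom V h"

definition fr :: "'a \<Rightarrow> real" where "fr x = real_of_ereal (f x)"
definition hr :: "'a \<Rightarrow> real" where "hr x = real_of_ereal (h x)"

lemma D_subset: "x \<in> D \<Longrightarrow> x \<in> V"
  by (simp add: edom_def)

lemma f_not_minus_infinity: "x \<in> V \<Longrightarrow> f x \<noteq> -\<infinity>"
  and h_not_minus_infinity: "x \<in> V \<Longrightarrow> h x \<noteq> -\<infinity>"
  using problem by (auto simp: problem_assms_def Conv_def proper_on_def)

lemma f_real: "x \<in> D \<Longrightarrow> f x = ereal (fr x)"
  using problem f_not_minus_infinity[of x]
  by (cases "f x") (auto simp: problem_assms_def edom_def fr_def)

lemma h_real: "x \<in> D \<Longrightarrow> h x = ereal (hr x)"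
  using h_not_minus_infinity[of x] by (cases "h x") (auto simp: edom_def hr_def)

lemma h_outside: "x \<in> V \<Longrightarrow> x \<notin> D \<Longrightarrow> h x = \<infinity>"
  by (auto simp: edom_def)

lemma h_convex_combination:
  assumes x: "x \<in> D" and y: "y \<in> D" and t: "0 < t" "t < 1"
  shows "(1 - t) *\<^sub>R x + t *\<^sub>R y \<in> D"
    and "hr ((1 - t) *\<^sub>R x + t *\<^sub>R y)
           \<le> (1 - t) * hr x + t * hr y - \<mu> / 2 * (t * (1 - t)) * (norm (x - y))\<^sup>2"
proof -
  let ?z = "(1 - t) *\<^sub>R x + t *\<^sub>R y"
  have zV: "?z \<in> V" using convex_V D_subset[OF x] D_subset[OF y] t by (intro convexD) auto
  have "h ?z - ereal (\<mu> * (norm ?z)\<^sup>2 / 2)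
     \<le> ereal (1 - t) * (h x - ereal (\<mu> * (norm x)\<^sup>2 / 2)) + ereal t * (h y - ereal (\<mu> * (norm y)\<^sup>2 / 2))"
    using problem D_subset[OF x] D_subset[OF y] t
    unfolding problem_assms_def Conv_def econvex_on_def by blast
  then have le: "h ?z - ereal (\<mu> * (norm ?z)\<^sup>2 / 2)
     \<le> ereal ((1 - t) * (hr x - \<mu> * (norm x)\<^sup>2 / 2) + t * (hr y - \<mu> * (norm y)\<^sup>2 / 2))"
    by (simp add: h_real[OF x] h_real[OF y])
  then show zD: "?z \<in> D" using zV by (cases "h ?z") (auto simp: edom_def)
  define N where "N = (norm ?z)\<^sup>2"
  have N: "N = (1 - t) * (norm x)\<^sup>2 + t * (norm y)\<^sup>2 - t * (1 - t) * (norm (x - y))\<^sup>2"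
    using norm_convex_combination_sq[of t x y 0] by (simp add: N_def)
  have "hr ?z - \<mu> * N / 2
     \<le> (1 - t) * (hr x - \<mu> * (norm x)\<^sup>2 / 2) + t * (hr y - \<mu> * (norm y)\<^sup>2 / 2)"
    using le by (simp add: h_real[OF zD] N_def)
  also have "\<dots> = (1 - t) * hr x + t * hr y - \<mu> / 2 * (t * (1 - t)) * (norm (x - y))\<^sup>2 - \<mu> * N / 2"
    unfolding N by (simp add: field_simps)
  finally show "hr ?z \<le> (1 - t) * hr x + t * hr y - \<mu> / 2 * (t * (1 - t)) * (norm (x - y))\<^sup>2"
    by simp
qed

sublocale hybrid_composite D fr hr f' M L \<mu>
proof
  show "convex D"
    unfolding convex_alt
  proof (intro ballI allI impI)
    fix x y and t :: real assume *: "x \<in> D" "y \<in> D" "0 \<le> t \<and> t \<le> 1"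
    consider "t = 0" | "t = 1" | "0 < t" "t < 1" using *(3) by linarith
    then show "(1 - t) *\<^sub>R x + t *\<^sub>R y \<in> D"
      using * by cases (auto intro: h_convex_combination(1))
  qed
  show "strongly_convex_on D \<mu> hr"
    unfolding strongly_convex_on_def
  proof (intro ballI allI impI)
    fix x y and t :: real assume *: "x \<in> D" "y \<in> D" "0 \<le> t \<and> t \<le> 1"
    consider "t = 0" | "t = 1" | "0 < t" "t < 1" using *(3) by linarith
    then show "hr ((1 - t) *\<^sub>R x + t *\<^sub>R y)
        \<le> (1 - t) * hr x + t * hr y - \<mu> / 2 * (t * (1 - t)) * (norm (x - y))\<^sup>2"
    proof cases
      case 3
      then show ?thesis by (rule h_convex_combination(2)[OF *(1,2)])
    qed auto
  qed
  show "fr x + inner (f' x) (u - x) \<le> fr u" if "x \<in> D" "u \<in> D" for x u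
  proof -
    have "f x + ereal (inner (f' x) (u - x)) \<le> f u"
      using problem that by (auto simp: problem_assms_def subdifferential_def D_subset)
    then show ?thesis by (simp add: f_real that)
  qed
qed (use problem in \<open>auto simp: problem_assms_def hybrid_bound_def\<close>)

abbreviation phi :: "'a \<Rightarrow> real" where "phi x \<equiv> fr x + hr x"

lemma objective_real: "x \<in> D \<Longrightarrow> objective f h x = ereal (phi x)"
  by (simp add: objective_def f_real h_real)

lemma objective_outside: "x \<in> V \<Longrightarrow> x \<notin> D \<Longrightarrow> objective f h x = \<infinity>"
  using f_not_minus_infinity[of x] by (simp add: objective_def h_outside)

lemma xs_dom: "xs \<in> D"
proof (rule ccontr)
  assume *: "xs \<notin> D"
  have "xs \<in> V" "objective f h xs \<le> objective f h x0"
    using xs_opt D_subset[OF x0_dom] by (auto simp: opt_set_def)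
  then show False using * x0_dom by (simp add: objective_outside objective_real)
qed

lemma xs_minimal:
  assumes "u \<in> D"
  shows "phi xs \<le> phi u"
proof -
  have "objective f h xs \<le> objective f h u"
    using xs_opt D_subset[OF assms] by (auto simp: opt_set_def)
  then show ?thesis by (simp add: objective_real assms xs_dom)
qed

lemma not_eps_solution:
  assumes "y \<in> D" "\<not> eps_solution V f h \<epsilon> y"
  shows "phi xs + \<epsilon> < phi y"
proof -
  have "opt_val V f h = objective f h xs"
    unfolding opt_val_def using xs_opt
    by (intro antisym INF_lower INF_greatest) (auto simp: opt_set_def)
  then show ?thesis
    using assms by (simp add: eps_solution_def objective_real xs_dom)
qed

text \<open>
  The linearizations are finite everywhere, so \<open>h\<close> alone decides where a model is finite, and that is
  on \<open>D\<close>. Hence proximal minimizers over \<open>V\<close> lie in \<open>D\<close>, and all estimates can be made for the real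
  function \<open>G\<close> in place of the extended-valued \<open>\<gamma>\<close>.
\<close>

definition represents :: "('a \<Rightarrow> ereal) \<Rightarrow> ('a \<Rightarrow> real) \<Rightarrow> bool" where
  "represents \<gamma> G \<longleftrightarrow> (\<forall>u\<in>D. \<gamma> u = ereal (G u)) \<and> (\<forall>u\<in>V - D. \<gamma> u = \<infinity>)"

lemma represents_cut:
  assumes "c \<in> D"
  shows "represents (\<lambda>u. linearization f f' c u + h u) (cut c)"
  using assms
  by (simp add: represents_def linearization_def cut_def f_real h_real h_outside)

lemma represents_combination:
  assumes "represents \<gamma> G" "represents \<gamma>' G'" "0 \<le> t" "t < 1"
  shows "represents (\<lambda>u. ereal t * \<gamma> u + ereal (1 - t) * \<gamma>' u) (\<lambda>u. t * G u + (1 - t) * G' u)"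
  using assms by (auto simp: represents_def)

definition prox_point :: "('a \<Rightarrow> real) \<Rightarrow> 'a \<Rightarrow> 'a \<Rightarrow> bool" where
  "prox_point G c x \<longleftrightarrow> x \<in> D \<and> (\<forall>u\<in>D. prox_value G lam c x \<le> prox_value G lam c u)"

lemma represents_prox_value:
  assumes "represents \<gamma> G" "u \<in> D"
  shows "\<gamma> u + ereal ((norm (u - c))\<^sup>2 / (2 * lam)) = ereal (prox_value G lam c u)"
  using assms by (simp add: represents_def prox_value_def)

lemma arg_min_prox_point:
  assumes rep: "represents \<gamma> G"
    and x: "is_arg_min (\<lambda>u. \<gamma> u + ereal ((norm (u - c))\<^sup>2 / (2 * lam))) (\<lambda>u. u \<in> V) x"
  shows "prox_point G c x"
proof -
  let ?p = "\<lambda>u. \<gamma> u + ereal ((norm (u - c))\<^sup>2 / (2 * lam))"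
  have xV: "x \<in> V" and le: "?p x \<le> ?p u" if "u \<in> D" for u
    using x D_subset[OF that] by (auto simp: is_arg_min_def not_less)
  have "x \<in> D"
  proof (rule ccontr)
    assume "x \<notin> D"
    then have "?p x = \<infinity>" using rep xV[OF x0_dom] by (simp add: represents_def)
    then show False using le[OF x0_dom] by (simp add: represents_prox_value[OF rep x0_dom])
  qed
  moreover have "prox_value G lam c x \<le> prox_value G lam c u" if "u \<in> D" for u
    using le[OF that] by (simp add: represents_prox_value[OF rep] that calculation)
  ultimately show ?thesis by (simp add: prox_point_def)
qed

section \<open>Length of a cycle and the invariant\<close>

text \<open>
  Trials with \<open>\<tau> \<ge> 1 - 2 / null_scale\<close> are always accepted. A rejected \<open>\<tau>\<close> is thus smaller, and its
  successor \<open>(1 + \<tau>) / 2\<close> is at most \<open>1 - 1 / null_scale\<close>, which is the contraction factor of a null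
  update.
\<close>

definition null_scale :: real where
  "null_scale = 2 * (1 + 8 * lambda_mu lam \<mu> * (M\<^sup>2 + \<epsilon> * L) / \<epsilon>)"

text \<open>
  The value of \<open>t_bar\<close> for the optimal point \<open>xs\<close> and the pair \<open>(M, L)\<close>.
\<close>

definition gap_bound :: real where
  "gap_bound = M\<^sup>2 + 4 * (L + 2) * (max 1 (2 * lam * L) * norm (x0 - xs) + lam * M)\<^sup>2"

definition cycle_length :: real where
  "cycle_length = null_scale * log_plus (4 * gap_bound / \<epsilon>) + 1"

abbreviation progress :: "nat \<Rightarrow> 'a \<Rightarrow> bool" where
  "progress K x \<equiv> serious_progress lam \<mu> \<epsilon> ((norm (x0 - xs))\<^sup>2) K ((norm (x - xs))\<^sup>2)"

lemma null_scale_ge: "null_scale \<ge> 2"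
  using params lam_pos eps_pos by (simp add: null_scale_def lambda_mu_def)

lemma cycle_length_ge: "cycle_length \<ge> 1"
  using null_scale_ge by (simp add: cycle_length_def log_plus_def)

text \<open>
  \<open>K\<close> cycles are closed and the running one has made \<open>n\<close> null updates after its serious update, which
  accounts for the summand \<open>1\<close>.
\<close>

definition open_cycle :: "nat \<Rightarrow> nat \<Rightarrow> 'a apb_state \<Rightarrow> bool" where
  "open_cycle K n s \<longleftrightarrow> (\<exists>t G.
     gap s = ereal t \<and> \<epsilon> / 2 < t \<and>
     real (completed s) \<le> real K * cycle_length + real n + 1 \<and>
     progress K (center s) \<and>
     strongly_convex_on D \<mu> G \<and> (\<forall>u\<in>D. G u \<le> phi u) \<and> represents (model s) G \<and>
     prox_point G (center s) (current s) \<and>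
     t = phi (best s) - prox_value G lam (center s) (current s) \<and>
     t - \<epsilon> / 4 \<le> (1 - 1 / null_scale) ^ n * (gap_bound - \<epsilon> / 4))"

definition closed_cycle :: "nat \<Rightarrow> 'a apb_state \<Rightarrow> bool" where
  "closed_cycle K s \<longleftrightarrow> gap s \<le> ereal (\<epsilon> / 2) \<and>
     real (completed s) \<le> real K * cycle_length \<and> progress K (current s)"

definition invariant :: "'a apb_state \<Rightarrow> bool" where
  "invariant s \<longleftrightarrow> current s \<in> D \<and> best s \<in> visited s \<and> visited s \<subseteq> D \<and>
     0 \<le> trial s \<and> trial s \<le> 1 - 1 / null_scale \<and>
     ((\<exists>K. closed_cycle K s) \<or> (\<exists>K n. open_cycle K n s))"

abbreviation total :: real where
  "total \<equiv> cycle_length * (cycle_bound lam \<mu> \<epsilon> (norm (x0 - xs)) + 1)"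

lemma progress_total:
  assumes "progress K x" "real c \<le> (real K + 1) * cycle_length"
  shows "real c \<le> total"
proof -
  have "real K \<le> cycle_bound lam \<mu> \<epsilon> (norm (x0 - xs))"
    by (rule serious_progress_count[OF assms(1)]) (use params lam_pos eps_pos in auto)
  then have "(real K + 1) * cycle_length \<le> (cycle_bound lam \<mu> \<epsilon> (norm (x0 - xs)) + 1) * cycle_length"
    using cycle_length_ge by (intro mult_right_mono) auto
  then show ?thesis using assms(2) by (simp add: mult.commute)
qed

lemma invariant_init:
  assumes "apb_init x0 s"
  shows "invariant s"
proof -
  have "closed_cycle 0 s"
    using assms eps_pos by (simp add: apb_init_def closed_cycle_def serious_progress_def zero_ereal_def)
  then show ?thesis
    using assms x0_dom null_scale_ge by (auto simp: invariant_def apb_init_def)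
qed

text \<open>
  A cycle that is still open after \<open>n\<close> null updates has room for one more: \<open>n + 2\<close> counts the serious
  update and the null update that comes next.
\<close>

lemma open_cycle_length:
  assumes "\<epsilon> / 2 < t" "t - \<epsilon> / 4 \<le> (1 - 1 / null_scale) ^ n * (gap_bound - \<epsilon> / 4)"
  shows "real n + 2 \<le> cycle_length"
proof -
  let ?s = "4 * gap_bound / \<epsilon>"
  have "\<epsilon> / 4 < (1 - 1 / null_scale) ^ n * (gap_bound - \<epsilon> / 4)" using assms by linarith
  then have "4 / \<epsilon> * (\<epsilon> / 4) < 4 / \<epsilon> * ((1 - 1 / null_scale) ^ n * (gap_bound - \<epsilon> / 4))"
    using eps_pos by (intro mult_strict_left_mono) auto
  also have "\<dots> = (1 - 1 / null_scale) ^ n * (?s - 1)" using eps_pos by (simp add: field_simps)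
  finally have "real n + 1 \<le> null_scale * ln ?s"
    using eps_pos by (intro geometric_decay_length null_scale_ge) simp
  moreover have "null_scale * ln ?s \<le> null_scale * log_plus ?s" if "?s > 0"
    using that null_scale_ge by (intro mult_left_mono) (auto simp: log_plus_def)
  moreover have "?s > 0"
  proof (rule ccontr)
    assume "\<not> ?s > 0"
    then have "gap_bound - \<epsilon> / 4 \<le> 0" using eps_pos by (simp add: zero_less_divide_iff)
    then have "(1 - 1 / null_scale) ^ n * (gap_bound - \<epsilon> / 4) \<le> 0"
      using null_scale_ge by (intro mult_nonneg_nonpos) auto
    then show False using assms eps_pos by linarith
  qed
  ultimately show ?thesis by (simp add: cycle_length_def)
qed

text \<open>
  What serious and null updates have in common after acceptance: the cycle closes, so that \<open>K\<close> grows by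
  one and the new iterate becomes the next center, or it stays open with its center.
\<close>

lemma accepted_invariant:
  assumes old: "visited s \<subseteq> D" "0 \<le> trial s" "trial s \<le> 1 - 1 / null_scale"
    and G: "strongly_convex_on D \<mu> G" "\<And>u. u \<in> D \<Longrightarrow> G u \<le> phi u" "represents \<gamma> G"
    and x: "prox_point G c x"
    and y: "y \<in> insert x (visited s)" "\<not> eps_solution V f h \<epsilon> y"
    and K: "progress K c" "real (completed s) \<le> real K * cycle_length + real n"
      "real n + 1 \<le> cycle_length"
    and t: "t = phi y - prox_value G lam c x" "t - \<epsilon> / 4 \<le> (1 - 1 / null_scale) ^ n * (gap_bound - \<epsilon> / 4)"
  shows "invariant \<lparr>completed = completed s + 1, visited = insert x (visited s), current = x,
      best = y, center = c, model = \<gamma>, gap = ereal t, trial = trial s / \<beta>\<rparr>" (is "invariant ?s")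
proof -
  have xD: "x \<in> D" using x by (simp add: prox_point_def)
  have yD: "y \<in> D" using y xD old by auto
  have "trial s / \<beta> \<le> trial s / 1" using old beta_ge by (intro divide_left_mono) auto
  then have trial: "0 \<le> trial s / \<beta>" "trial s / \<beta> \<le> 1 - 1 / null_scale" using old beta_ge by auto
  have "(\<exists>K. closed_cycle K ?s) \<or> (\<exists>K n. open_cycle K n ?s)"
  proof (cases "t \<le> \<epsilon> / 2")
    case True
    have "(1 + lam * \<mu>) * (norm (x - xs))\<^sup>2 + lam * \<epsilon> \<le> (norm (c - xs))\<^sup>2"
      by (rule serious_step_decrease[OF lam_pos G(1,2) _ _ xs_dom _ not_eps_solution[OF yD y(2)]])
         (use x True t(1) in \<open>auto simp: prox_point_def\<close>)
    then have "progress (Suc K) x"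
      by (rule serious_progress_Suc[OF K(1)]) (use lam_pos params in auto)
    moreover have "real (completed s + 1) \<le> real (Suc K) * cycle_length"
      using K(2,3) by (simp add: algebra_simps)
    ultimately have "closed_cycle (Suc K) ?s" using True by (simp add: closed_cycle_def)
    then show ?thesis by blast
  next
    case False
    then have "open_cycle K n ?s"
      unfolding open_cycle_def using K G x t by (intro exI[of _ t] exI[of _ G]) auto
    then show ?thesis by blast
  qed
  then show ?thesis using xD y(1) old(1) trial by (auto simp: invariant_def)
qed

section \<open>The transitions of the method\<close>

lemma apb_step_serious:
  assumes s: "current s \<in> D" "visited s \<subseteq> D" "0 \<le> trial s" "trial s \<le> 1 - 1 / null_scale"
    and K: "closed_cycle K s" and step: "apb_step V f f' h lam \<beta> \<epsilon> s s'"
  shows "completed s' = completed s + 1" "real (completed s') \<le> total"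
    "eps_solution V f h \<epsilon> (best s') \<or> invariant s'"
proof -
  let ?c = "current s"
  have ser: "serious \<epsilon> s" and K': "progress K ?c" "real (completed s) \<le> real K * cycle_length"
    using K by (auto simp: closed_cycle_def serious_def)
  have model: "new_model f f' h \<epsilon> s = (\<lambda>u. linearization f f' ?c u + h u)"
    using ser by (simp add: new_model_def fun_eq_iff)
  have prox: "prox_objective f f' h lam \<epsilon> s
      = (\<lambda>u. (linearization f f' ?c u + h u) + ereal ((norm (u - ?c))\<^sup>2 / (2 * lam)))"
    using ser by (simp add: prox_objective_def model new_center_def fun_eq_iff)
  have center: "new_center \<epsilon> s = ?c" using ser by (simp add: new_center_def)
  have small: "(ereal (\<epsilon> / 2) < gap s) = False" using ser by (simp add: serious_def not_less)
  from step obtain x y where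
    x: "is_arg_min (prox_objective f f' h lam \<epsilon> s) (\<lambda>u. u \<in> V) x" and
    y: "is_arg_min (objective f h) (\<lambda>z. z \<in> insert x (visited s)) y" and
    s': "s' = \<lparr>completed = completed s + 1, visited = insert x (visited s), current = x,
        best = y, center = ?c, model = new_model f f' h \<epsilon> s,
        gap = objective f h y - prox_objective f f' h lam \<epsilon> s x, trial = trial s / \<beta>\<rparr>"
    unfolding apb_step_def Let_def center small simp_thms if_False by blast
  note rep = represents_cut[OF s(1)]
  have xp: "prox_point (cut ?c) ?c x" using arg_min_prox_point[OF rep] x unfolding prox .
  then have xD: "x \<in> D" by (simp add: prox_point_def)
  have yin: "y \<in> insert x (visited s)" using y by (simp add: is_arg_min_def)
  then have yD: "y \<in> D" using xD s(2) by auto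
  have "objective f h y \<le> objective f h x" using y by (auto simp: is_arg_min_def not_less)
  then have yx: "phi y \<le> phi x" by (simp add: objective_real xD yD)
  define t where "t = phi y - prox_value (cut ?c) lam ?c x"
  have gap: "objective f h y - prox_objective f f' h lam \<epsilon> s x = ereal t"
    unfolding prox represents_prox_value[OF rep xD] by (simp add: objective_real yD t_def)
  have "norm (?c - xs) \<le> norm (x0 - xs)"
  proof (rule power2_le_imp_le)
    have "0 \<le> real K * (lam * \<epsilon>)" using lam_pos eps_pos by simp
    then show "(norm (?c - xs))\<^sup>2 \<le> (norm (x0 - xs))\<^sup>2"
      using K'(1) unfolding serious_progress_def by linarith
  qed simp
  then have "phi x - prox_value (cut ?c) lam ?c x \<le> gap_bound"
    unfolding gap_bound_def using xp
    by (intro serious_step_gap[OF lam_pos s(1) xs_dom xs_minimal]) (auto simp: prox_point_def)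
  then have t: "t \<le> gap_bound" using yx by (simp add: t_def)
  show "completed s' = completed s + 1" by (simp add: s')
  show "real (completed s') \<le> total"
    using K'(2) cycle_length_ge by (intro progress_total[OF K'(1)]) (simp add: s' algebra_simps)
  show "eps_solution V f h \<epsilon> (best s') \<or> invariant s'"
  proof (cases "eps_solution V f h \<epsilon> y")
    case False
    have "invariant s'"
      unfolding s' gap model
      by (rule accepted_invariant[OF s(2-4) cut_convex cut_le[OF s(1)] rep xp yin False K'(1),
            where n = 0])
         (use K'(2) cycle_length_ge t in \<open>auto simp: t_def\<close>)
    then show ?thesis ..
  qed (simp add: s')
qed

text \<open>
  The model of the next trial is built from the open cycle's model and center, so a rejection leaves
  the cycle as it is. An acceptance gives \<open>t' - \<epsilon> / 4 \<le> \<tau> * (t - \<epsilon> / 4)\<close> by the test itself.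
\<close>

lemma apb_step_null:
  assumes s: "current s \<in> D" "best s \<in> visited s" "visited s \<subseteq> D" "0 \<le> trial s" "trial s \<le> 1 - 1 / null_scale"
    and K: "open_cycle K n s" and step: "apb_step V f f' h lam \<beta> \<epsilon> s s'"
  shows "s' = s\<lparr>trial := (1 + trial s) / 2\<rparr> \<and> trial s < 1 - 2 / null_scale \<and> invariant s' \<or>
    completed s' = completed s + 1 \<and> real (completed s') \<le> total \<and>
      (eps_solution V f h \<epsilon> (best s') \<or> invariant s')"
proof -
  let ?c = "center s" and ?\<tau> = "trial s"
  from K obtain t G where gap: "gap s = ereal t" "\<epsilon> / 2 < t"
    and K': "real (completed s) \<le> real K * cycle_length + real n + 1" "progress K ?c"
    and G: "strongly_convex_on D \<mu> G" "\<And>u. u \<in> D \<Longrightarrow> G u \<le> phi u" "represents (model s) G"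
    and cur: "prox_point G ?c (current s)"
    and t: "t = phi (best s) - prox_value G lam ?c (current s)"
      "t - \<epsilon> / 4 \<le> (1 - 1 / null_scale) ^ n * (gap_bound - \<epsilon> / 4)"
    unfolding open_cycle_def by blast
  have "0 < 1 / null_scale" using null_scale_ge by simp
  then have tau: "0 \<le> ?\<tau>" "?\<tau> < 1" using s(4,5) by linarith+
  have nser: "\<not> serious \<epsilon> s" using gap by (simp add: serious_def)
  have center: "new_center \<epsilon> s = ?c" using nser by (simp add: new_center_def)
  define G' where "G' = (\<lambda>u. ?\<tau> * G u + (1 - ?\<tau>) * cut (current s) u)"
  have model: "new_model f f' h \<epsilon> s
      = (\<lambda>u. ereal ?\<tau> * model s u + ereal (1 - ?\<tau>) * (linearization f f' (current s) u + h u))"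
    using nser by (simp add: new_model_def fun_eq_iff)
  have rep: "represents (new_model f f' h \<epsilon> s) G'"
    unfolding model G'_def by (intro represents_combination G(3) represents_cut s(1) tau)
  have prox: "prox_objective f f' h lam \<epsilon> s
      = (\<lambda>u. new_model f f' h \<epsilon> s u + ereal ((norm (u - ?c))\<^sup>2 / (2 * lam)))"
    using nser by (simp add: prox_objective_def new_center_def fun_eq_iff)
  from step obtain x y where
    x: "is_arg_min (prox_objective f f' h lam \<epsilon> s) (\<lambda>u. u \<in> V) x" and
    y: "is_arg_min (objective f h) (\<lambda>z. z \<in> insert x (visited s)) y" and
    s': "s' = (if gap s > ereal (\<epsilon> / 2) \<and> objective f h y - prox_objective f f' h lam \<epsilon> s x
              > ereal ?\<tau> * gap s + ereal ((1 - ?\<tau>) * \<epsilon> / 4)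
            then s\<lparr>trial := (1 + ?\<tau>) / 2\<rparr>
            else \<lparr>completed = completed s + 1, visited = insert x (visited s), current = x,
                  best = y, center = ?c, model = new_model f f' h \<epsilon> s,
                  gap = objective f h y - prox_objective f f' h lam \<epsilon> s x, trial = ?\<tau> / \<beta>\<rparr>)"
    unfolding apb_step_def Let_def center by blast
  have xp: "prox_point G' ?c x" using arg_min_prox_point[OF rep] x unfolding prox .
  then have xD: "x \<in> D" by (simp add: prox_point_def)
  have yin: "y \<in> insert x (visited s)" using y by (simp add: is_arg_min_def)
  then have yD: "y \<in> D" using xD s(3) by auto
  have bD: "best s \<in> D" using s by auto
  have "objective f h y \<le> objective f h x" "objective f h y \<le> objective f h (best s)"
    using y s(2) by (auto simp: is_arg_min_def not_less)
  then have yx: "phi y \<le> phi x" "phi y \<le> phi (best s)" by (simp_all add: objective_real xD yD bD)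
  define t' where "t' = phi y - prox_value G' lam ?c x"
  have gap': "objective f h y - prox_objective f f' h lam \<epsilon> s x = ereal t'"
    unfolding prox represents_prox_value[OF rep xD] by (simp add: objective_real yD t'_def)
  show ?thesis
  proof (cases "t' > ?\<tau> * t + (1 - ?\<tau>) * \<epsilon> / 4")
    case True
    then have rej: "s' = s\<lparr>trial := (1 + ?\<tau>) / 2\<rparr>"
      using gap unfolding s' gap' by simp
    have small: "?\<tau> < 1 - 2 / null_scale"
    proof (rule ccontr)
      assume "\<not> ?\<tau> < 1 - 2 / null_scale"
      then have "t' \<le> ?\<tau> * (phi (best s) - prox_value G lam ?c (current s)) + (1 - ?\<tau>) * \<epsilon> / 4"
        unfolding t'_def G'_def using cur tau xD yx
        by (intro null_step_gap[OF lam_pos eps_pos _ _ _ _ G(1), where A = null_scale])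
           (auto simp: null_scale_def lambda_mu_def prox_point_def)
      then show False using True t by simp
    qed
    have "open_cycle K n s'" using K unfolding rej open_cycle_def by simp
    then have "invariant s'" using s small tau unfolding invariant_def by (auto simp: rej)
    then show ?thesis using rej small by blast
  next
    case False
    then have acc: "s' = \<lparr>completed = completed s + 1, visited = insert x (visited s), current = x,
                  best = y, center = ?c, model = new_model f f' h \<epsilon> s,
                  gap = ereal t', trial = ?\<tau> / \<beta>\<rparr>"
      using gap unfolding s' gap' by simp
    have "?\<tau> * t + (1 - ?\<tau>) * \<epsilon> / 4 - \<epsilon> / 4 = ?\<tau> * (t - \<epsilon> / 4)"
      by (simp add: field_simps)
    with False have "t' - \<epsilon> / 4 \<le> ?\<tau> * (t - \<epsilon> / 4)" by linarith
    also have "\<dots> \<le> (1 - 1 / null_scale) * (t - \<epsilon> / 4)"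
      using s(5) gap(2) eps_pos by (intro mult_right_mono) auto
    also have "\<dots> \<le> (1 - 1 / null_scale) * ((1 - 1 / null_scale) ^ n * (gap_bound - \<epsilon> / 4))"
      using null_scale_ge t(2) by (intro mult_left_mono) auto
    finally have t': "t' - \<epsilon> / 4 \<le> (1 - 1 / null_scale) ^ Suc n * (gap_bound - \<epsilon> / 4)"
      by (simp add: mult.assoc)
    note len = open_cycle_length[OF gap(2) t(2)]
    have "real (completed s') \<le> total"
      using K'(1) len by (intro progress_total[OF K'(2)]) (simp add: acc algebra_simps)
    moreover have "eps_solution V f h \<epsilon> (best s') \<or> invariant s'"
    proof (cases "eps_solution V f h \<epsilon> y")
      case False
      have minor: "G' u \<le> phi u" if "u \<in> D" for u
      proof -
        have "?\<tau> * G u + (1 - ?\<tau>) * cut (current s) u \<le> ?\<tau> * phi u + (1 - ?\<tau>) * phi u"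
          using tau G(2)[OF that] cut_le[OF s(1) that] by (intro add_mono mult_left_mono) auto
        then show ?thesis by (simp add: G'_def algebra_simps)
      qed
      have conv: "strongly_convex_on D \<mu> G'"
        unfolding G'_def using tau by (intro strongly_convex_on_combination[OF G(1) cut_convex]) simp_all
      have cnt: "real (completed s) \<le> real K * cycle_length + real (Suc n)" using K'(1) by simp
      have len': "real (Suc n) + 1 \<le> cycle_length" using len by simp
      have "invariant s'"
        unfolding acc
        by (rule accepted_invariant[OF s(3-5) conv minor rep xp yin False K'(2) cnt len' t'_def t'])
      then show ?thesis ..
    qed (simp add: acc)
    ultimately show ?thesis by (simp add: acc)
  qed
qed

lemma apb_step_invariant:
  assumes "invariant s" "apb_step V f f' h lam \<beta> \<epsilon> s s'"
  shows "s' = s\<lparr>trial := (1 + trial s) / 2\<rparr> \<and> trial s < 1 - 2 / null_scale \<and> invariant s' \<or>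
    completed s' = completed s + 1 \<and> real (completed s') \<le> total \<and>
      (eps_solution V f h \<epsilon> (best s') \<or> invariant s')"
proof -
  note inv = assms(1)[unfolded invariant_def]
  from inv consider K where "closed_cycle K s" | K n where "open_cycle K n s" by blast
  then show ?thesis
  proof cases
    case 1
    then show ?thesis using apb_step_serious[OF _ _ _ _ 1 assms(2)] inv by blast
  next
    case 2
    then show ?thesis using apb_step_null[OF _ _ _ _ _ 2 assms(2)] inv by blast
  qed
qed

text \<open>
  If no state within the bound had an \<open>\<epsilon>\<close>-solution, the invariant would hold forever and the number of
  completed iterations would stay bounded. From some point on all trials would then be rejected. But
  rejections drive \<open>\<tau>\<close> to \<open>1\<close>, past the threshold of certain acceptance.
\<close>

theorem apb_eps_solution:
  assumes run: "apb_run V f f' h x0 lam \<beta> \<epsilon> \<sigma>"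
  shows "\<exists>k. eps_solution V f h \<epsilon> (best (\<sigma> k)) \<and> real (completed (\<sigma> k)) \<le> total"
proof (rule ccontr)
  assume none: "\<nexists>k. eps_solution V f h \<epsilon> (best (\<sigma> k)) \<and> real (completed (\<sigma> k)) \<le> total"
  have step: "apb_step V f f' h lam \<beta> \<epsilon> (\<sigma> k) (\<sigma> (Suc k))" for k
    using run by (simp add: apb_run_def)
  have init: "apb_init x0 (\<sigma> 0)" using run by (simp add: apb_run_def)
  have inv: "invariant (\<sigma> k)" for k
  proof (induction k)
    case 0
    show ?case by (rule invariant_init[OF init])
  next
    case (Suc k)
    from apb_step_invariant[OF this step] none show ?case by blast
  qed
  have alt: "completed (\<sigma> (Suc k)) = completed (\<sigma> k) \<and>
        trial (\<sigma> (Suc k)) = (1 + trial (\<sigma> k)) / 2 \<and> trial (\<sigma> k) < 1 - 2 / null_scale \<or>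
      completed (\<sigma> (Suc k)) = completed (\<sigma> k) + 1 \<and> real (completed (\<sigma> (Suc k))) \<le> total" for k
    using apb_step_invariant[OF inv step, of k] by (elim disjE) simp_all
  have bounded: "completed (\<sigma> k) \<le> nat \<lfloor>total\<rfloor>" for k
  proof (induction k)
    case 0
    show ?case using init by (simp add: apb_init_def)
  next
    case (Suc k)
    from alt[of k] show ?case
    proof
      assume "completed (\<sigma> (Suc k)) = completed (\<sigma> k) + 1 \<and> real (completed (\<sigma> (Suc k))) \<le> total"
      then show ?thesis by (intro le_nat_floor) (rule conjunct2)
    next
      assume "completed (\<sigma> (Suc k)) = completed (\<sigma> k) \<and>
        trial (\<sigma> (Suc k)) = (1 + trial (\<sigma> k)) / 2 \<and> trial (\<sigma> k) < 1 - 2 / null_scale"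
      then show ?thesis using Suc by simp
    qed
  qed
  then have "\<exists>k. True \<and> (\<forall>i. True \<longrightarrow> completed (\<sigma> i) \<le> completed (\<sigma> k))"
    by (intro ex_has_greatest_nat[where b = "Suc (nat \<lfloor>total\<rfloor>)"]) (auto simp: less_Suc_eq_le)
  then obtain k where max: "completed (\<sigma> i) \<le> completed (\<sigma> k)" for i by blast
  have stuck: "completed (\<sigma> (k + i)) = completed (\<sigma> k)" for i
  proof (induction i)
    case (Suc i)
    have "completed (\<sigma> (Suc (k + i))) \<noteq> completed (\<sigma> (k + i)) + 1"
      using max[of "Suc (k + i)"] Suc by linarith
    with alt[of "k + i"] have "completed (\<sigma> (Suc (k + i))) = completed (\<sigma> (k + i))" by blast
    then show ?case using Suc by (simp only: add_Suc_right)
  qed simp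
  have rejected: "trial (\<sigma> (k + Suc i)) = (1 + trial (\<sigma> (k + i))) / 2 \<and> trial (\<sigma> (k + i)) < 1 - 2 / null_scale"
    for i
  proof -
    have "completed (\<sigma> (Suc (k + i))) \<noteq> completed (\<sigma> (k + i)) + 1"
      using stuck[of i] stuck[of "Suc i"] unfolding add_Suc_right by linarith
    with alt[of "k + i"] show ?thesis unfolding add_Suc_right by blast
  qed
  have "\<exists>i. 1 - 2 / null_scale \<le> trial (\<sigma> (k + i))"
  proof (rule halving_reaches_threshold)
    show "trial (\<sigma> (k + Suc i)) = (1 + trial (\<sigma> (k + i))) / 2" for i
      using rejected[of i] by (rule conjunct1)
    show "1 - 2 / null_scale < 1" using null_scale_ge by simp
  qed
  then show False using rejected by (meson not_le)
qed

end

section \<open>Existence of the nearest optimal point and of the best pair\<close>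

lemma unit_coordinate_vector:
  obtains e where "coord e = (\<lambda>i. if i = n then 1 else 0)"
proof -
  have "finite {i. (if i = n then 1 else 0 :: real) \<noteq> 0}" by (rule finite_subset[of _ "{n}"]) auto
  then show ?thesis using that[of "Abs_rvec (\<lambda>i. if i = n then 1 else 0)"]
    by (simp add: Abs_rvec_inverse)
qed

lemma convex_Rn: "convex (Rn n)"
  by (auto simp: convex_def Rn_def)

text \<open>
  The ambient space has infinite dimension, so its closed balls are not compact. Those of \<open>Rn n\<close> are, by
  induction on \<open>n\<close>: a bounded vector of \<open>Rn (n + 1)\<close> is a bounded vector of \<open>Rn n\<close> plus a bounded
  multiple of the last unit vector.
\<close>

lemma Rn_ball_in_compact: "\<exists>K. compact K \<and> {x \<in> Rn n. norm x \<le> r} \<subseteq> K \<and> K \<subseteq> Rn n"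
proof (induction n)
  case 0
  have "{x \<in> Rn 0. norm x \<le> r} \<subseteq> {0}" "{0} \<subseteq> Rn 0" by (auto simp: Rn_def rvec_eq_iff)
  then show ?case by (intro exI[of _ "{0}"]) auto
next
  case (Suc n)
  then obtain K where K: "compact K" "{x \<in> Rn n. norm x \<le> r} \<subseteq> K" "K \<subseteq> Rn n" by blast
  obtain e where e: "coord e = (\<lambda>i. if i = n then 1 else 0)" by (rule unit_coordinate_vector)
  have supp: "{i. coord e i \<noteq> 0} = {n}" by (auto simp: e)
  have inner_e: "inner e x = coord x n" for x
    by (simp add: inner_rvec_def dot_rvec_def supp) (simp add: e)
  have norm_e: "norm e = 1" by (simp add: norm_eq_sqrt_inner inner_e) (simp add: e)
  let ?F = "\<lambda>(x, a). x + a *\<^sub>R e"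
  have "compact (?F ` (K \<times> {-r..r}))"
    by (intro compact_continuous_image compact_Times K(1) compact_Icc)
       (auto intro!: continuous_intros simp: case_prod_beta)
  moreover have "?F ` (K \<times> {-r..r}) \<subseteq> Rn (Suc n)"
    using K(3) by (auto simp: Rn_def e)
  moreover have "{x \<in> Rn (Suc n). norm x \<le> r} \<subseteq> ?F ` (K \<times> {-r..r})"
  proof
    fix x assume "x \<in> {x \<in> Rn (Suc n). norm x \<le> r}"
    then have x: "x \<in> Rn (Suc n)" "norm x \<le> r" by auto
    define a where "a = coord x n"
    define y where "y = x - a *\<^sub>R e"
    have yR: "y \<in> Rn n"
      using x(1) by (auto simp: Rn_def y_def a_def e not_less_eq_eq dest: le_antisym)
    have "\<bar>a\<bar> \<le> norm x"
      using Cauchy_Schwarz_ineq2[of e x] by (simp add: inner_e norm_e a_def)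
    then have a: "a \<in> {-r..r}" using x(2) by auto
    have "(norm y)\<^sup>2 = (norm x)\<^sup>2 - a\<^sup>2"
      unfolding power2_norm_eq_inner y_def
      by (simp add: inner_diff_left inner_diff_right inner_e inner_commute[of x e] a_def
          power2_eq_square) (simp add: e)
    then have "(norm y)\<^sup>2 \<le> (norm x)\<^sup>2" by simp
    then have "norm y \<le> r" using x(2) power2_le_imp_le[of "norm y" "norm x"] by simp
    then have "y \<in> K" using K(2) yR by auto
    moreover have "x = ?F (y, a)" by (simp add: y_def)
    ultimately show "x \<in> ?F ` (K \<times> {-r..r})" using a by blast
  qed
  ultimately show ?case by blast
qed

text \<open>
  If \<open>f x + h x > c\<close>, then there are reals \<open>a < f x\<close> and \<open>b < h x\<close> with \<open>a + b \<ge> c\<close>, and lower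
  semicontinuity preserves both inequalities nearby. The value \<open>-\<infinity>\<close> has to be excluded: as
  \<open>-\<infinity> + \<infinity> = \<infinity>\<close>, the sum could jump up at \<open>x\<close>.
\<close>

lemma sublevel_set_closed:
  fixes f h :: "'a::metric_space \<Rightarrow> ereal" and c :: real
  assumes lsc: "lsc_on V f" "lsc_on V h"
    and fin: "\<And>x. x \<in> V \<Longrightarrow> f x \<noteq> -\<infinity>" "\<And>x. x \<in> V \<Longrightarrow> h x \<noteq> -\<infinity>"
    and K: "closed K" "K \<subseteq> V"
  shows "closed (K \<inter> {x. f x + h x \<le> ereal c})"
  unfolding closed_limpt
proof (intro allI impI)
  fix x let ?S = "K \<inter> {x. f x + h x \<le> ereal c}"
  assume lim: "x islimpt ?S"
  have xK: "x \<in> K" using lim K(1) islimpt_subset[of x ?S K] by (auto simp: closed_limpt)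
  then have xV: "x \<in> V" using K by auto
  have "f x + h x \<le> ereal c"
  proof (rule ccontr)
    assume "\<not> f x + h x \<le> ereal c"
    then have gt: "f x + h x > ereal c" by simp
    have "\<exists>a b. ereal a < f x \<and> ereal b < h x \<and> c \<le> a + b"
    proof (cases "f x")
      case (real r)
      show ?thesis
      proof (cases "h x")
        case r': (real r')
        have "c < r + r'" using gt real r' by simp
        then show ?thesis
          by (intro exI[of _ "r - (r + r' - c) / 2"] exI[of _ "r' - (r + r' - c) / 2"])
             (simp add: real r' field_simps)
      next
        case PInf
        then show ?thesis using real by (intro exI[of _ "r - 1"] exI[of _ "c - r + 1"]) auto
      qed (use fin xV in auto)
    next
      case PInf
      show ?thesis
      proof (cases "h x")
        case r': (real r')
        then show ?thesis using PInf by (intro exI[of _ "c - r' + 1"] exI[of _ "r' - 1"]) auto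
      next
        case p: PInf
        then show ?thesis using PInf by (intro exI[of _ c] exI[of _ 0]) auto
      qed (use fin xV in auto)
    qed (use fin xV in auto)
    then obtain a b where ab: "ereal a < f x" "ereal b < h x" "c \<le> a + b" by blast
    have "f x \<le> Liminf (at x within V) f" "h x \<le> Liminf (at x within V) h"
      using lsc xV by (auto simp: lsc_on_def)
    then have "\<forall>\<^sub>F y in at x within V. ereal a < f y" "\<forall>\<^sub>F y in at x within V. ereal b < h y"
      using ab by (auto simp: le_Liminf_iff)
    then have "\<forall>\<^sub>F y in at x within V. ereal c < f y + h y"
    proof eventually_elim
      case (elim y)
      have "ereal c \<le> ereal (a + b)" using ab by simp
      also have "\<dots> < f y + h y" using elim by (cases "f y"; cases "h y") auto
      finally show ?case .
    qed
    moreover have "at x within ?S \<le> at x within V" using K by (intro at_le) auto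
    ultimately have "\<forall>\<^sub>F y in at x within ?S. ereal c < f y + h y" by (rule filter_leD[rotated])
    moreover have "\<forall>\<^sub>F y in at x within ?S. y \<in> ?S" by (auto simp: eventually_at_filter)
    ultimately have "\<forall>\<^sub>F y in at x within ?S. False" by eventually_elim auto
    then show False using lim by (simp add: eventually_False trivial_limit_within)
  qed
  then show "x \<in> ?S" using xK by simp
qed

text \<open>
  This makes the choice operator in \<open>opt_dist\<close> meaningful: a continuous function is minimized over the
  part of the solution set that lies in a large ball.
\<close>

lemma opt_dist_attained:
  assumes prob: "problem_assms (Rn n) f f' h M L \<mu>" and x0: "x0 \<in> edom (Rn n) h"
  obtains xs where "xs \<in> opt_set (Rn n) f h" "opt_dist (Rn n) f h x0 = norm (x0 - xs)"
proof -
  let ?V = "Rn n" and ?X = "opt_set (Rn n) f h" and ?d = "\<lambda>x. norm (x0 - x)"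
  obtain x1 where x1: "x1 \<in> ?X" using prob by (auto simp: problem_assms_def)
  have x1V: "x1 \<in> ?V" using x1 by (simp add: opt_set_def)
  have inst: "apb_instance ?V f h f' M L \<mu> x0 x1 1 1 1"
    using prob x0 x1 by unfold_locales (auto simp: convex_Rn)
  interpret apb_instance ?V f h f' M L \<mu> x0 x1 1 1 1 by (rule inst)
  have X: "?X = {x \<in> ?V. f x + h x \<le> ereal (phi x1)}"
  proof -
    have "f x1 + h x1 = ereal (phi x1)" using objective_real[OF xs_dom] by (simp add: objective_def)
    then show ?thesis using x1 by (auto simp: opt_set_def objective_def intro: order_trans)
  qed
  obtain K where K: "compact K" "{x \<in> ?V. norm x \<le> norm x0 + ?d x1} \<subseteq> K" "K \<subseteq> ?V"
    using Rn_ball_in_compact by blast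
  have "closed (K \<inter> {x. f x + h x \<le> ereal (phi x1)})"
    using prob K f_not_minus_infinity h_not_minus_infinity
    by (intro sublevel_set_closed[of ?V]) (auto simp: problem_assms_def Conv_def compact_imp_closed)
  then have "compact (K \<inter> (K \<inter> {x. f x + h x \<le> ereal (phi x1)}))"
    by (rule compact_Int_closed[OF K(1)])
  moreover have "K \<inter> (K \<inter> {x. f x + h x \<le> ereal (phi x1)}) = K \<inter> ?X" using K(3) by (auto simp: X)
  ultimately have cpt: "compact (K \<inter> ?X)" by simp
  have inK: "x \<in> K" if "x \<in> ?X" "?d x \<le> ?d x1" for x
  proof -
    have "norm x \<le> norm x0 + ?d x" by (metis norm_minus_commute norm_triangle_sub)
    then show ?thesis using K(2) that by (auto simp: X)
  qed
  have ne: "K \<inter> ?X \<noteq> {}" using inK[OF x1] x1 by auto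
  have "continuous_on (K \<inter> ?X) ?d" by (intro continuous_intros)
  from continuous_attains_inf[OF cpt ne this]
  obtain y where y: "y \<in> K \<inter> ?X" "\<And>x. x \<in> K \<inter> ?X \<Longrightarrow> ?d y \<le> ?d x" by blast
  have "is_arg_min ?d (\<lambda>x. x \<in> ?X) y"
    unfolding is_arg_min_linorder
  proof (intro conjI allI impI)
    fix x assume x: "x \<in> ?X"
    show "?d y \<le> ?d x"
      using y(2)[of x] y(2)[of x1] inK[OF x] inK[OF x1] x x1 by (cases "?d x \<le> ?d x1") auto
  qed (use y in auto)
  then have "is_arg_min ?d (\<lambda>x. x \<in> ?X) (arg_min ?d (\<lambda>x. x \<in> ?X))"
    unfolding arg_min_def by (rule someI)
  then show ?thesis by (intro that) (auto simp: opt_dist_def is_arg_min_def)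
qed

text \<open>
  The set \<open>Omega\<close> is closed, and a sublevel set of the objective \<open>M\<^sup>2 + \<epsilon> * L\<close> in the quadrant is bounded.
\<close>

lemma best_pair_attained:
  assumes "(M, L) \<in> Omega V f' h" and eps: "\<epsilon> > 0"
  shows "best_pair V f' h \<epsilon> \<in> Omega V f' h"
proof -
  let ?v = "\<lambda>(M, L). M\<^sup>2 + \<epsilon> * (L::real)" and ?W = "Omega V f' h"
  define c where "c = M\<^sup>2 + \<epsilon> * L"
  define Q where "Q = {0..sqrt c} \<times> {0..c / \<epsilon>}"
  have "?W = {p. 0 \<le> fst p} \<inter> {p. 0 \<le> snd p} \<inter>
      (\<Inter>x\<in>edom V h. \<Inter>y\<in>edom V h. {p. norm (f' x - f' y) \<le> 2 * fst p + snd p * norm (x - y)})"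
    by (auto simp: Omega_def hybrid_bound_def)
  also have "closed \<dots>"
    by (intro closed_Int closed_INT ballI closed_Collect_le continuous_intros)
  finally have cl: "closed ?W" .
  have inQ: "p \<in> Q" if "p \<in> ?W" "?v p \<le> c" for p
  proof -
    obtain M' L' where p: "p = (M', L')" by (cases p)
    have nn: "0 \<le> M'" "0 \<le> L'" using that by (auto simp: p Omega_def)
    have "0 \<le> M'\<^sup>2" "0 \<le> \<epsilon> * L'" using nn eps by auto
    then have "M'\<^sup>2 \<le> c" "\<epsilon> * L' \<le> c" using that(2) unfolding p prod.case by linarith+
    then show ?thesis
      using nn eps by (auto simp: p Q_def real_le_rsqrt field_simps)
  qed
  have cpt: "compact (Q \<inter> ?W)"
    unfolding Q_def by (intro compact_Int_closed compact_Times compact_Icc cl)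
  have pair_in: "(M, L) \<in> Q \<inter> ?W" using assms(1) inQ[of "(M, L)"] by (simp add: c_def)
  have "continuous_on (Q \<inter> ?W) ?v"
    by (auto intro!: continuous_intros simp: case_prod_beta)
  from continuous_attains_inf[OF cpt _ this] pair_in
  obtain p where p: "p \<in> Q \<inter> ?W" "\<And>q. q \<in> Q \<inter> ?W \<Longrightarrow> ?v p \<le> ?v q" by blast
  have "is_arg_min ?v (\<lambda>p. p \<in> ?W) p"
    unfolding is_arg_min_linorder
  proof (intro conjI allI impI)
    fix q assume q: "q \<in> ?W"
    show "?v p \<le> ?v q"
      using p(2)[of q] p(2)[OF pair_in] inQ[OF q] q by (cases "?v q \<le> c") (auto simp: c_def)
  qed (use p in auto)
  then have "is_arg_min ?v (\<lambda>p. p \<in> ?W) (arg_min ?v (\<lambda>p. p \<in> ?W))"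
    unfolding arg_min_def by (rule someI)
  then show ?thesis by (simp add: best_pair_def is_arg_min_def)
qed

section \<open>The complexity bounds\<close>

lemma num_iterations_le:
  assumes prob: "problem_assms (Rn n) f f' h M L \<mu>" and x0: "x0 \<in> edom (Rn n) h"
    and pos: "lam > 0" "\<beta> \<ge> 1" "\<epsilon> > 0" and run: "apb_run (Rn n) f f' h x0 lam \<beta> \<epsilon> \<sigma>"
  shows "ereal_of_enat (num_iterations (Rn n) f h \<epsilon> \<sigma>)
     \<le> ereal (iteration_bound lam \<mu> \<epsilon> (T_eps (Rn n) f' h \<epsilon>) (opt_dist (Rn n) f h x0)
                (t_bar (Rn n) f f' h x0 lam \<epsilon>))"
proof -
  let ?V = "Rn n"
  obtain xs where xs: "xs \<in> opt_set ?V f h" "opt_dist ?V f h x0 = norm (x0 - xs)"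
    by (rule opt_dist_attained[OF prob x0])
  obtain M' L' where best: "best_pair ?V f' h \<epsilon> = (M', L')" by (cases "best_pair ?V f' h \<epsilon>")
  have "(M, L) \<in> Omega ?V f' h" using prob by (simp add: Omega_def problem_assms_def)
  from best_pair_attained[OF this pos(3)] have best': "M' \<ge> 0" "L' \<ge> 0" "hybrid_bound ?V f' h M' L'"
    by (auto simp: best Omega_def)
  have inst: "apb_instance ?V f h f' M' L' \<mu> x0 xs lam \<beta> \<epsilon>"
    using prob x0 xs pos best' by unfold_locales (auto simp: convex_Rn problem_assms_def)
  interpret apb_instance ?V f h f' M' L' \<mu> x0 xs lam \<beta> \<epsilon> by (rule inst)
  obtain k where k: "eps_solution ?V f h \<epsilon> (best (\<sigma> k))" "real (completed (\<sigma> k)) \<le> total"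
    using apb_eps_solution[OF run] by blast
  have "(T_eps ?V f' h \<epsilon>)\<^sup>2 = M'\<^sup>2 + \<epsilon> * L'"
    using best' pos by (simp add: T_eps_def best)
  moreover have "t_bar ?V f f' h x0 lam \<epsilon> = gap_bound"
    by (simp add: t_bar_def best gap_bound_def xs)
  ultimately have bound: "iteration_bound lam \<mu> \<epsilon> (T_eps ?V f' h \<epsilon>) (opt_dist ?V f h x0)
      (t_bar ?V f f' h x0 lam \<epsilon>) = total"
    by (simp add: iteration_bound_def cycle_length_def null_scale_def cycle_bound_def xs)
  have "num_iterations ?V f h \<epsilon> \<sigma> \<le> enat (completed (\<sigma> k))"
    unfolding num_iterations_def using k by (intro INF_lower) simp
  then have "ereal_of_enat (num_iterations ?V f h \<epsilon> \<sigma>) \<le> ereal_of_enat (enat (completed (\<sigma> k)))"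
    by (simp only: ereal_of_enat_le_iff)
  also have "\<dots> \<le> ereal total" using k by simp
  finally show ?thesis unfolding bound .
qed

text \<open>
  Put \<open>X = lam * T\<^sup>2 / \<epsilon>\<close> and \<open>Y = d\<^sup>2 / (lam * \<epsilon>)\<close>; the hypotheses say that \<open>C * X \<ge> 1\<close> and \<open>C * Y \<ge> 1\<close>. So in
  \<open>(1 + 8 * X) * (Y + 1)\<close> all terms are dominated by \<open>X * Y\<close>, which gives the first term of the order. For
  the second, put \<open>z = lam * \<mu>\<close>, \<open>w = \<mu> * d\<^sup>2 / \<epsilon>\<close> and \<open>U = T\<^sup>2 / (\<mu> * \<epsilon>)\<close>. The lower bound on \<open>lam\<close> reads
  \<open>1 / z \<le> C * U\<close>, so that \<open>Q \<le> (1 / z + 1) * ln (1 + w)\<close> has the required form. The delicate term is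
  \<open>lambda_mu lam \<mu> * T\<^sup>2 / \<epsilon> = U * (z / (1 + z))\<close>, which carries no logarithm: here the upper bound on
  \<open>lam\<close> gives \<open>z \<le> C * w\<close>, and this makes \<open>z / (1 + z)\<close> at most a multiple of \<open>ln (1 + w)\<close>.
\<close>

lemma iteration_bound_le_complexity_order:
  fixes T d t :: real
  assumes C: "C > 0" and lam: "lam > 0" and mu: "\<mu> \<ge> 0" and eps: "\<epsilon> > 0" and T: "T > 0"
    and lo: "\<epsilon> / (C * T\<^sup>2) \<le> lam" and hi: "lam \<le> C * d\<^sup>2 / \<epsilon>"
  shows "iteration_bound lam \<mu> \<epsilon> T d t
     \<le> 34 * (C + 1)\<^sup>2 * (1 + log_plus (4 * t / \<epsilon>)) * complexity_order \<mu> \<epsilon> T d"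
proof -
  define l where "l = log_plus (4 * t / \<epsilon>)"
  define \<Lambda> where "\<Lambda> = lambda_mu lam \<mu>"
  define S where "S = 1 + 8 * \<Lambda> * T\<^sup>2 / \<epsilon>"
  define Q where "Q = cycle_bound lam \<mu> \<epsilon> d"
  define X where "X = lam * T\<^sup>2 / \<epsilon>"
  define Y where "Y = d\<^sup>2 / (lam * \<epsilon>)"
  define c where "c = C + 1"
  have c: "c \<ge> 1" "C \<le> c" using C by (auto simp: c_def)
  have l: "l \<ge> 0" by (simp add: l_def log_plus_def)
  have \<Lambda>: "0 \<le> \<Lambda>" "\<Lambda> \<le> lam"
    using lam mu by (auto simp: \<Lambda>_def lambda_mu_def divide_le_eq mult_le_cancel_left1)
  have S: "S \<ge> 1" using \<Lambda> eps by (simp add: S_def)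
  have X: "1 \<le> C * X" using lo C T eps lam by (simp add: X_def field_simps)
  have Y: "1 \<le> C * Y" using hi lam eps by (simp add: Y_def field_simps)
  have X0: "X > 0" using lam T eps by (simp add: X_def)
  have Y0: "Y \<ge> 0" using lam eps by (simp add: Y_def)
  have Q0: "Q \<ge> 0"
    using lam mu eps Y0
    by (auto simp: Q_def cycle_bound_def Y_def lambda_mu_def intro!: divide_nonneg_nonneg ln_ge_zero)
  have cyc: "iteration_bound lam \<mu> \<epsilon> T d t = (2 * S * l + 1) * (Q + 1)"
    by (simp add: iteration_bound_def S_def \<Lambda>_def l_def Q_def cycle_bound_def)
  have "(2 * S * l + 1) * (Q + 1) \<le> (2 * S * (1 + l)) * (Q + 1)"
    using S Q0 l by (intro mult_right_mono) (auto simp: algebra_simps)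
  then have 1: "iteration_bound lam \<mu> \<epsilon> T d t \<le> 2 * (1 + l) * (S * (Q + 1))"
    unfolding cyc by (simp add: algebra_simps)
  have SX: "S \<le> 1 + 8 * X"
  proof -
    have "\<Lambda> * T\<^sup>2 / \<epsilon> \<le> lam * T\<^sup>2 / \<epsilon>"
      using \<Lambda> eps by (intro divide_right_mono mult_right_mono) auto
    then show ?thesis by (simp add: S_def X_def)
  qed
  have XY: "X * Y = T\<^sup>2 * d\<^sup>2 / \<epsilon>\<^sup>2"
    using lam eps by (simp add: X_def Y_def power2_eq_square)
  have first: "S * (Q + 1) \<le> 17 * c\<^sup>2 * (X * Y)"
  proof -
    have "Q \<le> Y" by (simp add: Q_def cycle_bound_def Y_def)
    then have "S * (Q + 1) \<le> (1 + 8 * X) * (Y + 1)" using SX S Q0 by (intro mult_mono) auto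
    also have "\<dots> \<le> (C * X + 8 * X) * (Y + C * Y)"
      using X Y X0 Y0 by (intro mult_mono add_mono) auto
    also have "\<dots> = (C + 8) * c * (X * Y)" by (simp add: c_def algebra_simps)
    also have "\<dots> \<le> (17 * c) * c * (X * Y)"
      using c X0 Y0 C by (intro mult_right_mono) (auto simp: c_def)
    finally show ?thesis by (simp add: power2_eq_square mult.assoc)
  qed
  have second: "S * (Q + 1) \<le> 17 * c\<^sup>2 * ((T\<^sup>2 / (\<mu> * \<epsilon>) + 1) * ln (\<mu> * d\<^sup>2 / \<epsilon> + 1) + 1)"
    if mu_pos: "\<mu> > 0"
  proof -
    define w where "w = \<mu> * d\<^sup>2 / \<epsilon>"
    define z where "z = lam * \<mu>"
    define U where "U = T\<^sup>2 / (\<mu> * \<epsilon>)"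
    define G where "G = ln (w + 1)"
    have z: "z > 0" using lam mu_pos by (simp add: z_def)
    have w: "w \<ge> 0" using mu_pos eps by (simp add: w_def)
    have U: "U > 0" using mu_pos eps T by (simp add: U_def)
    have G: "G \<ge> 0" using w by (simp add: G_def)
    have \<Lambda>z: "\<mu> * \<Lambda> = z / (1 + z)" by (simp add: \<Lambda>_def lambda_mu_def z_def)
    have S_eq: "S = 1 + 8 * (U * (z / (1 + z)))"
      using mu_pos eps by (simp add: S_def U_def \<Lambda>z[symmetric] field_simps)
    have zw: "z \<le> C * w"
    proof -
      have "\<mu> * lam \<le> \<mu> * (C * d\<^sup>2 / \<epsilon>)" using hi mu_pos by (intro mult_left_mono) auto
      then show ?thesis by (simp add: z_def w_def algebra_simps)
    qed
    have zG: "z / (1 + z) \<le> c * G"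
    proof -
      \<comment> \<open>With \<open>c \<ge> 1\<close>: \<open>z / (1 + z) \<le> c * w / (1 + w) \<le> c * ln (1 + w)\<close>.\<close>
      have "z \<le> c * w" using zw mult_right_mono[OF c(2) w] by linarith
      have "ln (1 / (w + 1)) \<le> 1 / (w + 1) - 1" using w by (intro ln_le_minus_one) simp
      then have "w / (w + 1) \<le> G" using w by (simp add: G_def ln_div field_simps)
      then have "c * (w / (w + 1)) \<le> c * G" using c by (intro mult_left_mono) auto
      moreover have "z / (1 + z) \<le> c * (w / (w + 1))"
      proof -
        have "z * (w + 1) \<le> c * w * (1 + z)"
        proof -
          have "z * w \<le> c * (z * w)" using c(1) z w mult_right_mono[of 1 c "z * w"] by simp
          then show ?thesis using \<open>z \<le> c * w\<close> by (simp add: algebra_simps)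
        qed
        then show ?thesis using z w by (simp add: divide_simps)
      qed
      ultimately show ?thesis by linarith
    qed
    have Q_le: "Q \<le> (1 + z) / z * G"
      using mu_pos by (simp add: Q_def cycle_bound_def \<Lambda>_def[symmetric] \<Lambda>z G_def w_def)
    have z_inv: "1 / z \<le> c * U"
    proof -
      have "1 / z * 1 \<le> 1 / z * (C * X)" using X z by (intro mult_left_mono) auto
      also have "1 / z * (C * X) = C * U"
        using lam mu_pos eps by (simp add: z_def X_def U_def field_simps)
      also have "\<dots> \<le> c * U" using c U by (intro mult_right_mono) auto
      finally show ?thesis by simp
    qed
    have "S * (Q + 1) = Q + 8 * U * (z / (1 + z)) * Q + (1 + 8 * U * (z / (1 + z)))"
      by (simp add: S_eq algebra_simps add_divide_distrib)
    moreover have "Q \<le> c * U * G + G"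
    proof -
      have "(1 + z) / z * G = 1 / z * G + G" using z by (simp add: field_simps)
      also have "\<dots> \<le> c * U * G + G" using z_inv G by (intro add_right_mono mult_right_mono) auto
      finally show ?thesis using Q_le by linarith
    qed
    moreover have "8 * U * (z / (1 + z)) * Q \<le> 8 * U * G"
    proof -
      have "8 * U * (z / (1 + z)) * Q \<le> 8 * U * (z / (1 + z)) * ((1 + z) / z * G)"
        using Q_le U z by (intro mult_left_mono) auto
      also have "\<dots> = 8 * U * G * ((z / (1 + z)) * ((1 + z) / z))" by (simp only: mult_ac)
      also have "\<dots> = 8 * U * G" using z by simp
      finally show ?thesis .
    qed
    moreover have "8 * U * (z / (1 + z)) \<le> 8 * U * (c * G)"
      using zG U by (intro mult_left_mono) auto
    moreover have "c * (U * G) \<ge> U * G" using c U G mult_right_mono[of 1 c "U * G"] by simp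
    moreover have "c * G \<ge> G" using c G mult_right_mono[of 1 c G] by simp
    ultimately have "S * (Q + 1) \<le> 17 * c * (U * G) + c * G + 1" by (simp add: algebra_simps)
    also have "\<dots> \<le> 17 * c * ((U + 1) * G + 1)"
    proof -
      have "17 * c * ((U + 1) * G + 1) = 17 * c * (U * G) + 17 * (c * G) + 17 * c"
        by (simp add: algebra_simps)
      moreover have "0 \<le> c * G" using c G by simp
      ultimately show ?thesis using c by linarith
    qed
    also have "\<dots> \<le> 17 * c\<^sup>2 * ((U + 1) * G + 1)"
      using c U G by (intro mult_right_mono) (auto simp: power2_eq_square)
    finally show ?thesis by (simp add: U_def G_def w_def)
  qed
  have "S * (Q + 1) \<le> 17 * c\<^sup>2 * complexity_order \<mu> \<epsilon> T d"
  proof -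
    have "17 * c\<^sup>2 * (X * Y) \<le> 17 * c\<^sup>2 * (X * Y + 1)" by (intro mult_left_mono) auto
    with first have "S * (Q + 1) \<le> 17 * c\<^sup>2 * (T\<^sup>2 * d\<^sup>2 / \<epsilon>\<^sup>2 + 1)" unfolding XY by linarith
    then show ?thesis
      using second mu by (auto simp: complexity_order_def min_def)
  qed
  then have "2 * (1 + l) * (S * (Q + 1)) \<le> 2 * (1 + l) * (17 * c\<^sup>2 * complexity_order \<mu> \<epsilon> T d)"
    using l by (intro mult_left_mono) auto
  also have "\<dots> = 34 * c\<^sup>2 * (1 + l) * complexity_order \<mu> \<epsilon> T d" by (simp add: algebra_simps)
  finally show ?thesis using 1 unfolding c_def l_def by linarith
qed

theorem theorem5p3:
  shows
  "(\<forall>n f f' h M L \<mu> x0 lam \<beta> \<epsilon> \<sigma>.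
      problem_assms (Rn n) f f' h M L \<mu> \<and> x0 \<in> edom (Rn n) h \<and> lam > 0 \<and> \<beta> \<ge> 1 \<and> \<epsilon> > 0 \<and>
      apb_run (Rn n) f f' h x0 lam \<beta> \<epsilon> \<sigma> \<longrightarrow>
      ereal_of_enat (num_iterations (Rn n) f h \<epsilon> \<sigma>)
        \<le> ereal (iteration_bound lam \<mu> \<epsilon> (T_eps (Rn n) f' h \<epsilon>) (opt_dist (Rn n) f h x0)
                  (t_bar (Rn n) f f' h x0 lam \<epsilon>))) \<and>
   (\<forall>C>0. \<exists>C'>0. \<forall>n f f' h M L \<mu> x0 lam \<beta> \<epsilon> \<sigma>.
      problem_assms (Rn n) f f' h M L \<mu> \<and> x0 \<in> edom (Rn n) h \<and> lam > 0 \<and> \<beta> \<ge> 1 \<and> \<epsilon> > 0 \<and>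
      apb_run (Rn n) f f' h x0 lam \<beta> \<epsilon> \<sigma> \<and>
      T_eps (Rn n) f' h \<epsilon> > 0 \<and>
      \<epsilon> / (C * (T_eps (Rn n) f' h \<epsilon>)\<^sup>2) \<le> lam \<and> lam \<le> C * (opt_dist (Rn n) f h x0)\<^sup>2 / \<epsilon> \<longrightarrow>
      ereal_of_enat (num_iterations (Rn n) f h \<epsilon> \<sigma>)
        \<le> ereal (C' * (1 + log_plus (4 * t_bar (Rn n) f f' h x0 lam \<epsilon> / \<epsilon>)) *
                  complexity_order \<mu> \<epsilon> (T_eps (Rn n) f' h \<epsilon>) (opt_dist (Rn n) f h x0)))"
proof (intro conjI allI impI)
  fix n f f' h M L \<mu> x0 lam \<beta> \<epsilon> \<sigma>
  assume "problem_assms (Rn n) f f' h M L \<mu> \<and> x0 \<in> edom (Rn n) h \<and> lam > 0 \<and> \<beta> \<ge> 1 \<and> \<epsilon> > 0 \<and>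
      apb_run (Rn n) f f' h x0 lam \<beta> \<epsilon> \<sigma>"
  then show "ereal_of_enat (num_iterations (Rn n) f h \<epsilon> \<sigma>)
        \<le> ereal (iteration_bound lam \<mu> \<epsilon> (T_eps (Rn n) f' h \<epsilon>) (opt_dist (Rn n) f h x0)
                  (t_bar (Rn n) f f' h x0 lam \<epsilon>))"
    by (blast intro: num_iterations_le)
next
  fix C :: real assume C: "C > 0"
  show "\<exists>C'>0. \<forall>n f f' h M L \<mu> x0 lam \<beta> \<epsilon> \<sigma>.
      problem_assms (Rn n) f f' h M L \<mu> \<and> x0 \<in> edom (Rn n) h \<and> lam > 0 \<and> \<beta> \<ge> 1 \<and> \<epsilon> > 0 \<and>
      apb_run (Rn n) f f' h x0 lam \<beta> \<epsilon> \<sigma> \<and>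
      T_eps (Rn n) f' h \<epsilon> > 0 \<and>
      \<epsilon> / (C * (T_eps (Rn n) f' h \<epsilon>)\<^sup>2) \<le> lam \<and> lam \<le> C * (opt_dist (Rn n) f h x0)\<^sup>2 / \<epsilon> \<longrightarrow>
      ereal_of_enat (num_iterations (Rn n) f h \<epsilon> \<sigma>)
        \<le> ereal (C' * (1 + log_plus (4 * t_bar (Rn n) f f' h x0 lam \<epsilon> / \<epsilon>)) *
                  complexity_order \<mu> \<epsilon> (T_eps (Rn n) f' h \<epsilon>) (opt_dist (Rn n) f h x0))"
  proof (intro exI[of _ "34 * (C + 1)\<^sup>2"] conjI allI impI)
    fix n f f' h M L \<mu> x0 lam \<beta> \<epsilon> \<sigma>
    assume *: "problem_assms (Rn n) f f' h M L \<mu> \<and> x0 \<in> edom (Rn n) h \<and> lam > 0 \<and> \<beta> \<ge> 1 \<and> \<epsilon> > 0 \<and>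
      apb_run (Rn n) f f' h x0 lam \<beta> \<epsilon> \<sigma> \<and>
      T_eps (Rn n) f' h \<epsilon> > 0 \<and>
      \<epsilon> / (C * (T_eps (Rn n) f' h \<epsilon>)\<^sup>2) \<le> lam \<and> lam \<le> C * (opt_dist (Rn n) f h x0)\<^sup>2 / \<epsilon>"
    then have "ereal_of_enat (num_iterations (Rn n) f h \<epsilon> \<sigma>)
        \<le> ereal (iteration_bound lam \<mu> \<epsilon> (T_eps (Rn n) f' h \<epsilon>) (opt_dist (Rn n) f h x0)
                  (t_bar (Rn n) f f' h x0 lam \<epsilon>))"
      by (blast intro: num_iterations_le)
    also have "\<dots> \<le> ereal (34 * (C + 1)\<^sup>2 * (1 + log_plus (4 * t_bar (Rn n) f f' h x0 lam \<epsilon> / \<epsilon>)) *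
                  complexity_order \<mu> \<epsilon> (T_eps (Rn n) f' h \<epsilon>) (opt_dist (Rn n) f h x0))"
      using * C
      by (simp only: ereal_less_eq, intro iteration_bound_le_complexity_order)
         (auto simp: problem_assms_def)
    finally show "ereal_of_enat (num_iterations (Rn n) f h \<epsilon> \<sigma>)
        \<le> ereal (34 * (C + 1)\<^sup>2 * (1 + log_plus (4 * t_bar (Rn n) f f' h x0 lam \<epsilon> / \<epsilon>)) *
                  complexity_order \<mu> \<epsilon> (T_eps (Rn n) f' h \<epsilon>) (opt_dist (Rn n) f h x0))" .
  qed (use C in simp)
qed

end
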